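(* Let $n\ge1$ and let $F$ be a non-Riemannian homogeneous Randers metric on $S^{4n+3}$ with $I_0(S^{4n+3},F)=Sp(n+1)U(1)$. Then any Killing vector field of constant length for $F$ is generated by a central vector in the Lie algebra $\mathfrak{sp}(n+1)\oplus\mathfrak{u}(1)$ of the isometry group.
   Context: $I_0(M,F)$ denotes the identity component of the full isometry group of the Finsler manifold $(M,F)$; $F$ is homogeneous if $I_0(M,F)$ acts transitively on $M$. A Randers metric is a Finsler metric $F=\alpha+\beta$ with $\alpha$ a Riemannian metric and $\beta$ a 1-form of $\alpha$-length everywhere less than $1$; non-Riemannian means $\beta\neq 0$. $S^{4n+3}$ is the unit sphere in $\mathbb{H}^{n+1}$ (column vectors). $Sp(n+1)U(1)$ is the group of transformations $v\mapsto Av\lambda$ of $S^{4n+3}$, with $A\in Sp(n+1)$ (quaternionic unitary matrices, acting by left multiplication) and $\lambda\in U(1)\subset\mathbb{C}=\mathbb{R}\oplus\mathbb{R}\mathbf{i}\subset\mathbb{H}$ acting by right multiplication. An element $(X,x)\in\mathfrak{sp}(n+1)\oplus\mathbb{R}$ of its Lie algebra generates the Killing vector field $v\mapsto Xv+xv\mathbf{i}$; the center of the Lie algebra is $\{(0,x):x\in\mathbb{R}\}$. A Killing vector field $Y$ has constant length if $v\mapsto F(v,Y(v))$ is constant. *)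

theory Defs
  imports "HOL-Analysis.Analysis"
begin

section \<open>Quaternions\<close>

datatype quat = Quat (qRe: real) (qI: real) (qJ: real) (qK: real)

lemma quat_eq_iff: "x = y \<longleftrightarrow> qRe x = qRe y \<and> qI x = qI y \<and> qJ x = qJ y \<and> qK x = qK y"
  by (cases x; cases y) auto

instantiation quat :: ring_1
begin

definition "0 = Quat 0 0 0 0"
definition "1 = Quat 1 0 0 0"
definition "x + y = Quat (qRe x + qRe y) (qI x + qI y) (qJ x + qJ y) (qK x + qK y)"
definition "- x = Quat (- qRe x) (- qI x) (- qJ x) (- qK x)"
definition "x - y = Quat (qRe x - qRe y) (qI x - qI y) (qJ x - qJ y) (qK x - qK y)"
definition "x * y = Quat
  (qRe x * qRe y - qI x * qI y - qJ x * qJ y - qK x * qK y)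
  (qRe x * qI y + qI x * qRe y + qJ x * qK y - qK x * qJ y)
  (qRe x * qJ y - qI x * qK y + qJ x * qRe y + qK x * qI y)
  (qRe x * qK y + qI x * qJ y - qJ x * qI y + qK x * qRe y)"

instance
  by standard
    (simp_all add: quat_eq_iff zero_quat_def one_quat_def plus_quat_def uminus_quat_def
      minus_quat_def times_quat_def algebra_simps)

end

lemma quat_zero_sel [simp]: "qRe 0 = 0" "qI 0 = 0" "qJ 0 = 0" "qK 0 = 0"
  by (simp_all add: zero_quat_def)

lemma quat_one_sel [simp]: "qRe 1 = 1" "qI 1 = 0" "qJ 1 = 0" "qK 1 = 0"
  by (simp_all add: one_quat_def)

lemma quat_plus_sel [simp]:
  "qRe (x + y) = qRe x + qRe y" "qI (x + y) = qI x + qI y"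
  "qJ (x + y) = qJ x + qJ y" "qK (x + y) = qK x + qK y"
  by (simp_all add: plus_quat_def)

lemma quat_uminus_sel [simp]:
  "qRe (- x) = - qRe x" "qI (- x) = - qI x" "qJ (- x) = - qJ x" "qK (- x) = - qK x"
  by (simp_all add: uminus_quat_def)

lemma quat_minus_sel [simp]:
  "qRe (x - y) = qRe x - qRe y" "qI (x - y) = qI x - qI y"
  "qJ (x - y) = qJ x - qJ y" "qK (x - y) = qK x - qK y"
  by (simp_all add: minus_quat_def)

lemma quat_times_sel [simp]:
  "qRe (x * y) = qRe x * qRe y - qI x * qI y - qJ x * qJ y - qK x * qK y"
  "qI (x * y) = qRe x * qI y + qI x * qRe y + qJ x * qK y - qK x * qJ y"
  "qJ (x * y) = qRe x * qJ y - qI x * qK y + qJ x * qRe y + qK x * qI y"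
  "qK (x * y) = qRe x * qK y + qI x * qJ y - qJ x * qI y + qK x * qRe y"
  by (simp_all add: times_quat_def)

instantiation quat :: real_algebra_1
begin

definition "scaleR r x = Quat (r * qRe x) (r * qI x) (r * qJ x) (r * qK x)"

instance
  by standard (simp_all add: quat_eq_iff scaleR_quat_def algebra_simps)

end

lemma quat_scaleR_sel [simp]:
  "qRe (r *\<^sub>R x) = r * qRe x" "qI (r *\<^sub>R x) = r * qI x"
  "qJ (r *\<^sub>R x) = r * qJ x" "qK (r *\<^sub>R x) = r * qK x"
  by (simp_all add: scaleR_quat_def)

instantiation quat :: real_inner
begin

definition inner_quat_def:
  "inner x y = qRe x * qRe y + qI x * qI y + qJ x * qJ y + qK x * qK y"

definition norm_quat_def:
  "norm (x :: quat) = sqrt ((qRe x)\<^sup>2 + (qI x)\<^sup>2 + (qJ x)\<^sup>2 + (qK x)\<^sup>2)"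

definition sgn_quat_def: "sgn (x :: quat) = x /\<^sub>R norm x"

definition dist_quat_def: "dist x y = norm (x - y :: quat)"

definition uniformity_quat_def [code del]:
  "(uniformity :: (quat \<times> quat) filter) = (INF e\<in>{0 <..}. principal {(x, y). dist x y < e})"

definition open_quat_def [code del]:
  "open (U :: quat set) \<longleftrightarrow> (\<forall>x\<in>U. eventually (\<lambda>(x', y). x' = x \<longrightarrow> y \<in> U) uniformity)"

instance
proof
  fix x y z :: quat and r :: real
  show "inner x x = 0 \<longleftrightarrow> x = 0"
    unfolding inner_quat_def by (simp add: add_nonneg_eq_0_iff quat_eq_iff)
  show "norm x = sqrt (inner x x)"
    unfolding inner_quat_def norm_quat_def by (simp add: power2_eq_square)
  show "inner x y = inner y x"
    unfolding inner_quat_def by (simp add: mult.commute)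
  show "inner (x + y) z = inner x z + inner y z"
    unfolding inner_quat_def by (simp add: distrib_right)
  show "inner (scaleR r x) y = r * inner x y"
    unfolding inner_quat_def by (simp add: distrib_left mult.assoc)
  show "0 \<le> inner x x"
    unfolding inner_quat_def by simp
qed (rule sgn_quat_def dist_quat_def open_quat_def uniformity_quat_def)+

end

instantiation quat :: euclidean_space
begin

definition Basis_quat_def:
  "Basis = {Quat 1 0 0 0, Quat 0 1 0 0, Quat 0 0 1 0, Quat 0 0 0 1}"

instance
proof
  fix u v x :: quat
  show "(Basis :: quat set) \<noteq> {}" "finite (Basis :: quat set)"
    by (simp_all add: Basis_quat_def)
  show "inner u v = (if u = v then 1 else 0)" if "u \<in> Basis" "v \<in> Basis"
    using that unfolding Basis_quat_def inner_quat_def by (elim insertE emptyE) simp_all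
  show "(\<forall>u\<in>Basis. inner x u = 0) \<longleftrightarrow> x = 0"
    unfolding Basis_quat_def inner_quat_def quat_eq_iff[of x 0] by simp
qed

end

definition quat_cnj :: "quat \<Rightarrow> quat" where
  "quat_cnj x = Quat (qRe x) (- qI x) (- qJ x) (- qK x)"

definition quat_of_complex :: "complex \<Rightarrow> quat" where
  "quat_of_complex z = Quat (Re z) (Im z) 0 0"

section \<open>Smoothness\<close>

fun C_on :: "nat \<Rightarrow> 'a::real_normed_vector set \<Rightarrow> ('a \<Rightarrow> 'b::real_normed_vector) \<Rightarrow> bool" where
  "C_on 0 U f \<longleftrightarrow> continuous_on U f"
| "C_on (Suc k) U f \<longleftrightarrow>
     (\<forall>x\<in>U. f differentiable (at x)) \<and> (\<forall>v. C_on k U (\<lambda>x. frechet_derivative f (at x) v))"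

text \<open>Smoothness of a map on an arbitrary subset of a Euclidean space: local extendability to
  smooth maps on open sets.  On an embedded submanifold this is intrinsic smoothness.\<close>

definition smooth_on :: "'a::euclidean_space set \<Rightarrow> ('a \<Rightarrow> 'b::euclidean_space) \<Rightarrow> bool" where
  "smooth_on A f \<longleftrightarrow>
     (\<forall>x\<in>A. \<exists>U h. open U \<and> x \<in> U \<and> (\<forall>k. C_on k U h) \<and> (\<forall>y\<in>A \<inter> U. h y = f y))"

section \<open>Finsler and Randers metrics on the unit sphere of a Euclidean space\<close>

text \<open>Tangent vectors at a point of the sphere are vectors of the ambient space orthogonal to it;
  (co)tensor fields are functions on the ambient space of which only the values at points of the
  sphere and tangent vectors matter.\<close>

abbreviation usphere :: "'a::euclidean_space set" where
  "usphere \<equiv> sphere 0 1"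

definition tangent :: "'a::euclidean_space \<Rightarrow> 'a set" where
  "tangent p = {v. inner p v = 0}"

definition fundamental_tensor ::
    "('a::euclidean_space \<Rightarrow> 'a \<Rightarrow> real) \<Rightarrow> 'a \<Rightarrow> 'a \<Rightarrow> 'a \<Rightarrow> 'a \<Rightarrow> real" where
  "fundamental_tensor F p y u v =
     (1/2) * deriv (\<lambda>s. deriv (\<lambda>t. (F p (y + s *\<^sub>R u + t *\<^sub>R v))\<^sup>2) 0) 0"

definition finsler_metric :: "('a::euclidean_space \<Rightarrow> 'a \<Rightarrow> real) \<Rightarrow> bool" where
  "finsler_metric F \<longleftrightarrow>
     continuous_on {(p, v). p \<in> usphere \<and> v \<in> tangent p} (\<lambda>(p, v). F p v) \<and>
     smooth_on {(p, v). p \<in> usphere \<and> v \<in> tangent p \<and> v \<noteq> 0} (\<lambda>(p, v). F p v) \<and>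
     (\<forall>p\<in>usphere. \<forall>v\<in>tangent p. v \<noteq> 0 \<longrightarrow> F p v > 0) \<and>
     (\<forall>p\<in>usphere. \<forall>v\<in>tangent p. \<forall>c\<ge>0. F p (c *\<^sub>R v) = c * F p v) \<and>
     (\<forall>p\<in>usphere. \<forall>y\<in>tangent p. \<forall>u\<in>tangent p.
        y \<noteq> 0 \<longrightarrow> u \<noteq> 0 \<longrightarrow> fundamental_tensor F p y u u > 0)"

definition riemannian_metric :: "('a::euclidean_space \<Rightarrow> 'a \<Rightarrow> 'a \<Rightarrow> real) \<Rightarrow> bool" where
  "riemannian_metric g \<longleftrightarrow>
     smooth_on {(p, u, v). p \<in> usphere \<and> u \<in> tangent p \<and> v \<in> tangent p} (\<lambda>(p, u, v). g p u v) \<and>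
     (\<forall>p\<in>usphere. \<forall>u\<in>tangent p. \<forall>v\<in>tangent p. g p u v = g p v u) \<and>
     (\<forall>p\<in>usphere. \<forall>u\<in>tangent p. \<forall>v\<in>tangent p. \<forall>w\<in>tangent p. \<forall>a b.
        g p (a *\<^sub>R u + b *\<^sub>R v) w = a * g p u w + b * g p v w) \<and>
     (\<forall>p\<in>usphere. \<forall>v\<in>tangent p. v \<noteq> 0 \<longrightarrow> g p v v > 0)"

definition one_form :: "('a::euclidean_space \<Rightarrow> 'a \<Rightarrow> real) \<Rightarrow> bool" where
  "one_form \<beta> \<longleftrightarrow>
     smooth_on {(p, v). p \<in> usphere \<and> v \<in> tangent p} (\<lambda>(p, v). \<beta> p v) \<and>
     (\<forall>p\<in>usphere. \<forall>u\<in>tangent p. \<forall>v\<in>tangent p. \<forall>a b.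
        \<beta> p (a *\<^sub>R u + b *\<^sub>R v) = a * \<beta> p u + b * \<beta> p v)"

definition covector_length ::
    "('a::euclidean_space \<Rightarrow> 'a \<Rightarrow> 'a \<Rightarrow> real) \<Rightarrow> ('a \<Rightarrow> 'a \<Rightarrow> real) \<Rightarrow> 'a \<Rightarrow> real" where
  "covector_length g \<beta> p = (SUP v\<in>{v \<in> tangent p. g p v v = 1}. \<bar>\<beta> p v\<bar>)"

definition randers_decomposition ::
    "('a::euclidean_space \<Rightarrow> 'a \<Rightarrow> real) \<Rightarrow> ('a \<Rightarrow> 'a \<Rightarrow> 'a \<Rightarrow> real) \<Rightarrow> ('a \<Rightarrow> 'a \<Rightarrow> real) \<Rightarrow> bool" where
  "randers_decomposition F g \<beta> \<longleftrightarrow>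
     finsler_metric F \<and> riemannian_metric g \<and> one_form \<beta> \<and>
     (\<forall>p\<in>usphere. covector_length g \<beta> p < 1) \<and>
     (\<forall>p\<in>usphere. \<forall>v\<in>tangent p. F p v = sqrt (g p v v) + \<beta> p v)"

definition non_riemannian_randers :: "('a::euclidean_space \<Rightarrow> 'a \<Rightarrow> real) \<Rightarrow> bool" where
  "non_riemannian_randers F \<longleftrightarrow>
     (\<exists>g \<beta>. randers_decomposition F g \<beta> \<and> (\<exists>p\<in>usphere. \<exists>v\<in>tangent p. \<beta> p v \<noteq> 0))"

section \<open>Isometries and Killing vector fields\<close>

text \<open>Self-maps of the sphere are represented as extensional functions, so that equality of maps is
  equality of functions.  The derivative of a map at \<open>p\<close> within the sphere is unique only on tangent
  vectors.\<close>

definition isometries :: "('a::euclidean_space \<Rightarrow> 'a \<Rightarrow> real) \<Rightarrow> ('a \<Rightarrow> 'a) set" where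
  "isometries F = {\<phi> \<in> usphere \<rightarrow>\<^sub>E usphere.
     bij_betw \<phi> usphere usphere \<and> smooth_on usphere \<phi> \<and> smooth_on usphere (inv_into usphere \<phi>) \<and>
     (\<forall>p\<in>usphere. \<exists>D. (\<phi> has_derivative D) (at p within usphere) \<and>
        (\<forall>v\<in>tangent p. F (\<phi> p) (D v) = F p v))}"

definition compact_open_topology :: "'a::topological_space set \<Rightarrow> ('a \<Rightarrow> 'a) topology" where
  "compact_open_topology S = topology_generated_by
     {{\<phi> \<in> S \<rightarrow>\<^sub>E S. continuous_on S \<phi> \<and> \<phi> ` K \<subseteq> U} | K U. compact K \<and> K \<subseteq> S \<and> open U}"

definition identity_component :: "('a::euclidean_space \<Rightarrow> 'a \<Rightarrow> real) \<Rightarrow> ('a \<Rightarrow> 'a) set" where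
  "identity_component F =
     connected_component_of_set (subtopology (compact_open_topology usphere) (isometries F))
       (restrict id usphere)"

definition homogeneous_metric :: "('a::euclidean_space \<Rightarrow> 'a \<Rightarrow> real) \<Rightarrow> bool" where
  "homogeneous_metric F \<longleftrightarrow>
     (\<forall>p\<in>usphere. \<forall>q\<in>usphere. \<exists>\<phi>\<in>identity_component F. \<phi> p = q)"

text \<open>A Killing vector field is one whose flow consists of isometries; as the sphere is compact, the
  flow is defined for all times.\<close>

definition killing_field :: "('a::euclidean_space \<Rightarrow> 'a \<Rightarrow> real) \<Rightarrow> ('a \<Rightarrow> 'a) \<Rightarrow> bool" where
  "killing_field F Y \<longleftrightarrow>
     smooth_on usphere Y \<and> (\<forall>p\<in>usphere. Y p \<in> tangent p) \<and>
     (\<exists>\<phi> :: real \<Rightarrow> 'a \<Rightarrow> 'a. (\<forall>t. \<phi> t \<in> isometries F) \<and> (\<forall>p\<in>usphere. \<phi> 0 p = p) \<and>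
        (\<forall>p\<in>usphere. \<forall>t. ((\<lambda>s. \<phi> s p) has_vector_derivative Y (\<phi> t p)) (at t)))"

definition constant_length :: "('a::euclidean_space \<Rightarrow> 'a \<Rightarrow> real) \<Rightarrow> ('a \<Rightarrow> 'a) \<Rightarrow> bool" where
  "constant_length F Y \<longleftrightarrow> (\<exists>c. \<forall>p\<in>usphere. F p (Y p) = c)"

section \<open>The group $Sp(n+1)U(1)$ and its Lie algebra\<close>

definition conj_transpose :: "quat^'m^'m \<Rightarrow> quat^'m^'m" where
  "conj_transpose A = (\<chi> i j. quat_cnj (A $ j $ i))"

definition right_mult :: "quat^'m \<Rightarrow> quat \<Rightarrow> quat^'m" where
  "right_mult v q = (\<chi> i. v $ i * q)"

definition Sp :: "(quat^'m^'m) set" where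
  "Sp = {A. conj_transpose A ** A = mat 1 \<and> A ** conj_transpose A = mat 1}"

definition U1 :: "quat set" where
  "U1 = quat_of_complex ` {z. norm z = 1}"

definition Sp_U1 :: "(quat^'m \<Rightarrow> quat^'m) set" where
  "Sp_U1 = {restrict (\<lambda>v. right_mult (A *v v) q) usphere | A q. A \<in> Sp \<and> q \<in> U1}"

text \<open>The Lie algebra of $U(1)$ is identified with the reals through $x \mapsto x\mathbf{i}$; the bracket
  vanishes on it.\<close>

definition sp_u1 :: "((quat^'m^'m) \<times> real) set" where
  "sp_u1 = {(X, x). conj_transpose X = - X}"

definition sp_u1_bracket ::
    "(quat^'m^'m) \<times> real \<Rightarrow> (quat^'m^'m) \<times> real \<Rightarrow> (quat^'m^'m) \<times> real" where
  "sp_u1_bracket = (\<lambda>(X, x) (Y, y). (X ** Y - Y ** X, 0))"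

definition sp_u1_center :: "((quat^'m^'m) \<times> real) set" where
  "sp_u1_center = {z \<in> sp_u1. \<forall>w\<in>sp_u1. sp_u1_bracket z w = 0}"

definition generated_field :: "(quat^'m^'m) \<times> real \<Rightarrow> quat^'m \<Rightarrow> quat^'m" where
  "generated_field = (\<lambda>(X, x) v. X *v v + x *\<^sub>R right_mult v (quat_of_complex \<i>))"

end

theory Submission
  imports Defs
begin

text \<open>
  By homogeneity \<open>F\<close> is determined by its values at one point, where the isotropy representation of
  \<open>Sp(n+1)U(1)\<close> forces \<open>F(v, w) = sqrt (a|w\<^sub>h|\<^sup>2 + b h\<^sub>i\<^sup>2 + c (h\<^sub>j\<^sup>2 + h\<^sub>k\<^sup>2)) + d h\<^sub>i\<close>; here
  \<open>h = v\<^sup>*w\<close> is the quaternionic hermitian product and \<open>w\<^sub>h\<close> the part of \<open>w\<close> orthogonal to \<open>v\<close> over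
  the quaternions.  If \<open>a = c\<close>, this metric is invariant under \<open>U(2n+2)\<close>, which is larger than
  \<open>Sp(n+1)U(1)\<close>; so \<open>a \<noteq> c\<close>.  For a field \<open>v \<mapsto> Xv + xv\<i>\<close> of constant length, replacing \<open>v\<close> by \<open>vt\<close> with
  a unit quaternion \<open>t\<close> such that the \<open>\<i>\<close>-component of \<open>(vt)\<^sup>*X(vt)\<close> vanishes shows that
  \<open>a|Xv|\<^sup>2 + (c - a)|v\<^sup>*Xv|\<^sup>2\<close> is constant on the sphere.  Evaluating this on \<open>e\<^sub>i\<close>, \<open>e\<^sub>ju\<close> and
  \<open>(e\<^sub>i \<plusminus> e\<^sub>ju)/sqrt 2\<close> for unit quaternions \<open>u\<close> gives, as \<open>a \<noteq> c\<close>,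
  \<open>|X\<^sub>i\<^sub>i - u\<^sup>*X\<^sub>j\<^sub>ju| = 2|Im (u\<^sup>*X\<^sub>j\<^sub>i)|\<close> for all \<open>u\<close>, which is only possible if \<open>X = 0\<close>.
\<close>

section \<open>Quaternions and the action of $Sp(n+1)U(1)$\<close>

lemma quat_cnj_sel [simp]:
  "qRe (quat_cnj x) = qRe x" "qI (quat_cnj x) = - qI x"
  "qJ (quat_cnj x) = - qJ x" "qK (quat_cnj x) = - qK x"
  by (simp_all add: quat_cnj_def)

lemma quat_of_complex_sel [simp]:
  "qRe (quat_of_complex z) = Re z" "qI (quat_of_complex z) = Im z"
  "qJ (quat_of_complex z) = 0" "qK (quat_of_complex z) = 0"
  by (simp_all add: quat_of_complex_def)

lemma quat_sum_sel:
  "qRe (\<Sum>i\<in>S. f i) = (\<Sum>i\<in>S. qRe (f i))" "qI (\<Sum>i\<in>S. f i) = (\<Sum>i\<in>S. qI (f i))"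
  "qJ (\<Sum>i\<in>S. f i) = (\<Sum>i\<in>S. qJ (f i))" "qK (\<Sum>i\<in>S. f i) = (\<Sum>i\<in>S. qK (f i))"
  by (induction S rule: infinite_finite_induct; simp)+

lemma quat_norm_sq: "(norm (x :: quat))\<^sup>2 = (qRe x)\<^sup>2 + (qI x)\<^sup>2 + (qJ x)\<^sup>2 + (qK x)\<^sup>2"
  by (simp add: norm_quat_def)

lemma norm_quat_1 [simp]: "norm (1 :: quat) = 1"
  by (simp add: norm_quat_def)

lemma quat_cnj_add: "quat_cnj (x + y) = quat_cnj x + quat_cnj y"
  by (simp add: quat_eq_iff)

lemma quat_cnj_sum: "quat_cnj (\<Sum>i\<in>S. f i) = (\<Sum>i\<in>S. quat_cnj (f i))"
  by (induction S rule: infinite_finite_induct) (simp_all add: quat_cnj_add, simp_all add: quat_eq_iff)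

lemma quat_cnj_mult: "quat_cnj (x * y) = quat_cnj y * quat_cnj x"
  by (simp add: quat_eq_iff algebra_simps)

lemma quat_cnj_cnj [simp]: "quat_cnj (quat_cnj x) = x"
  by (simp add: quat_eq_iff)

lemma quat_cnj_0 [simp]: "quat_cnj 0 = 0" and quat_cnj_1 [simp]: "quat_cnj 1 = 1"
  by (simp_all add: quat_eq_iff)

lemma quat_cnj_mult_self: "quat_cnj x * x = of_real ((norm x)\<^sup>2)" "x * quat_cnj x = of_real ((norm x)\<^sup>2)"
  by (simp_all add: quat_eq_iff of_real_def quat_norm_sq) (simp_all add: power2_eq_square)

text \<open>After squaring this is Euler's four-square identity, a polynomial identity in the eight
  coordinates.\<close>

lemma quat_norm_mult: "norm (x * y :: quat) = norm x * norm y"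
proof -
  have "(norm (x * y))\<^sup>2 = (norm x * norm y)\<^sup>2"
    unfolding power_mult_distrib quat_norm_sq by (simp add: power2_eq_square algebra_simps)
  then show ?thesis by simp
qed

lemma quat_norm_cnj [simp]: "norm (quat_cnj x) = norm x"
  by (simp add: norm_quat_def)

lemma U1_iff: "q \<in> U1 \<longleftrightarrow> qJ q = 0 \<and> qK q = 0 \<and> (qRe q)\<^sup>2 + (qI q)\<^sup>2 = 1"
proof
  assume "q \<in> U1"
  then obtain z where z: "q = quat_of_complex z" "norm z = 1" by (auto simp: U1_def)
  have "(Re z)\<^sup>2 + (Im z)\<^sup>2 = 1" using z(2) by (simp flip: cmod_power2)
  then show "qJ q = 0 \<and> qK q = 0 \<and> (qRe q)\<^sup>2 + (qI q)\<^sup>2 = 1"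
    using z by simp
next
  assume a: "qJ q = 0 \<and> qK q = 0 \<and> (qRe q)\<^sup>2 + (qI q)\<^sup>2 = 1"
  have "q = quat_of_complex (Complex (qRe q) (qI q))" by (simp add: quat_eq_iff a)
  moreover have "norm (Complex (qRe q) (qI q)) = 1" using a by (simp add: cmod_def)
  ultimately show "q \<in> U1" unfolding U1_def by blast
qed

lemma U1_norm: "q \<in> U1 \<Longrightarrow> norm q = 1"
  by (simp add: U1_iff norm_quat_def)

lemma unit_cnj_mult: "norm q = 1 \<Longrightarrow> quat_cnj q * q = 1" "norm q = 1 \<Longrightarrow> q * quat_cnj q = 1"
  by (simp_all add: quat_cnj_mult_self)

text \<open>Conjugation by a unit quaternion in the span of 1 and k rotates the plane of the i and j
  components by twice its angle, so some angle sends the i component to zero.\<close>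

lemma unit_quat_rotation_zero_I:
  "\<exists>t. norm t = 1 \<and> qI (quat_cnj t * h * t) = 0"
proof -
  obtain r \<phi> where r: "qI h = r * cos \<phi>" "qJ h = r * sin \<phi>" using polar_Ex by metis
  \<comment> \<open>The i component after conjugation is
    \<open>r * cos (2 * \<theta> - \<phi>)\<close>; this choice makes the argument
    \<open>pi / 2\<close>.\<close>
  define \<theta> where "\<theta> = \<phi> / 2 + pi / 4"
  define t where "t = Quat (cos \<theta>) 0 0 (sin \<theta>)"
  have "qI (quat_cnj t * h * t) = qI h * ((cos \<theta>)\<^sup>2 - (sin \<theta>)\<^sup>2) + qJ h * (2 * sin \<theta> * cos \<theta>)"
    by (simp add: t_def algebra_simps power2_eq_square)
  also have "\<dots> = qI h * cos (2 * \<theta>) + qJ h * sin (2 * \<theta>)"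
    by (simp add: cos_double sin_double)
  also have "2 * \<theta> = \<phi> + pi / 2" by (simp add: \<theta>_def)
  also have "qI h * cos (\<phi> + pi / 2) + qJ h * sin (\<phi> + pi / 2) = 0"
    by (simp add: r cos_add sin_add)
  finally show ?thesis
    by (intro exI[of _ t]) (simp add: t_def norm_quat_def)
qed

text \<open>Write \<open>\<mu> = m *\<^sub>R u0\<close>. Taking \<open>u = u0\<close> makes the
  right side vanish, so \<open>p\<close> is conjugate to \<open>q\<close>, and substituting
  \<open>u0 * t\<close> leaves an identity in \<open>q\<close> and \<open>m\<close> alone. Testing
  it at a \<open>t\<close> parallel to \<open>q\<close>, at i and at j leaves only zero.\<close>

lemma quat_conj_sandwich_rigid:
  assumes q: "qRe q = 0" and p: "qRe p = 0"
    and eq: "\<And>u. norm u = 1 \<Longrightarrow> (norm (q - quat_cnj u * p * u))\<^sup>2 =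
      4 * ((norm (quat_cnj u * \<mu>))\<^sup>2 - (qRe (quat_cnj u * \<mu>))\<^sup>2)"
  shows "q = 0" "\<mu> = 0"
proof -
  define m where "m = norm \<mu>"
  \<comment> \<open>Polar form of \<open>\<mu>\<close>; for \<open>\<mu> = 0\<close> any unit
    quaternion serves, and 1 is taken.\<close>
  obtain u0 where u0: "norm u0 = 1" "\<mu> = m *\<^sub>R u0"
  proof (cases "\<mu> = 0")
    case True then show ?thesis using that[of 1] by (simp add: m_def norm_quat_def)
  next
    case False then show ?thesis using that[of "\<mu> /\<^sub>R m"] by (simp add: m_def)
  qed
  have u0m: "quat_cnj u0 * \<mu> = of_real m"
    using unit_cnj_mult[OF u0(1)] by (simp add: u0(2) of_real_def)
  have nr: "norm (of_real m :: quat) = \<bar>m\<bar>" "qRe (of_real m) = m" for m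
    by (simp_all add: norm_quat_def of_real_def)
  have pq: "q = quat_cnj u0 * p * u0"
    using eq[OF u0(1)] by (simp add: u0m nr)
  have E: "(norm (q - quat_cnj t * q * t))\<^sup>2 = 4 * (m\<^sup>2 - m\<^sup>2 * (qRe t)\<^sup>2)" if t: "norm t = 1" for t
  proof -
    have 1: "quat_cnj (u0 * t) * \<mu> = m *\<^sub>R quat_cnj t"
      by (simp add: quat_cnj_mult mult.assoc u0m) (simp add: of_real_def)
    have 2: "quat_cnj (u0 * t) * p * (u0 * t) = quat_cnj t * q * t"
      by (simp add: quat_cnj_mult mult.assoc pq)
    show ?thesis
      using eq[of "u0 * t"] t u0(1) unfolding 1 2 by (simp add: quat_norm_mult power_mult_distrib)
  qed
  have "m = 0 \<or> q = 0"
  proof (rule ccontr)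
    assume n: "\<not> (m = 0 \<or> q = 0)"
    \<comment> \<open>This imaginary unit commutes with \<open>q\<close>, so the left side of
      \<open>E\<close> is 0 while the right side is 4 times the square of \<open>m\<close>.\<close>
    define t where "t = q /\<^sub>R norm q"
    have t: "norm t = 1" using n by (simp add: t_def)
    have "quat_cnj t * q * t = quat_cnj t * t * q"
      by (simp add: t_def mult.assoc)
    then have "quat_cnj t * q * t = q" by (simp add: unit_cnj_mult t)
    with E[OF t] n show False by (simp add: t_def q)
  qed
  \<comment> \<open>Conjugation by i negates the j and k components, and conjugation by j the i and
    k components; once \<open>q\<close> or \<open>m\<close> is 0, the two equations force the other
    to be 0.\<close>
  moreover have I: "4 * ((qJ q)\<^sup>2 + (qK q)\<^sup>2) = 4 * m\<^sup>2"
    using E[of "Quat 0 1 0 0"] by (simp add: quat_norm_sq norm_quat_def power2_eq_square)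
  moreover have J: "4 * ((qI q)\<^sup>2 + (qK q)\<^sup>2) = 4 * m\<^sup>2"
    using E[of "Quat 0 0 1 0"] by (simp add: quat_norm_sq norm_quat_def power2_eq_square)
  ultimately have "m = 0 \<and> q = 0"
    by (auto simp: quat_eq_iff q add_nonneg_eq_0_iff)
  then show "q = 0" "\<mu> = 0" by (auto simp: u0)
qed

section \<open>The quaternionic hermitian product and the linear action of the group\<close>

definition hprod :: "quat^'m \<Rightarrow> quat^'m \<Rightarrow> quat" where
  "hprod p w = (\<Sum>i\<in>UNIV. quat_cnj (p $ i) * w $ i)"

lemma qRe_hprod: "qRe (hprod p w) = inner p w"
  by (simp add: hprod_def quat_sum_sel inner_vec_def inner_quat_def)

lemma right_mult_nth [simp]: "right_mult v q $ i = v $ i * q"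
  by (simp add: right_mult_def)

lemma hprod_right_mult:
  "hprod p (right_mult w q) = hprod p w * q"
  "hprod (right_mult p q) w = quat_cnj q * hprod p w"
  by (simp_all add: hprod_def sum_distrib_left sum_distrib_right mult.assoc quat_cnj_mult)

lemma hprod_add: "hprod p (v + w) = hprod p v + hprod p w" "hprod (v + w) p = hprod v p + hprod w p"
  by (simp_all add: hprod_def algebra_simps quat_cnj_add sum.distrib)

lemma hprod_scaleR: "hprod p (r *\<^sub>R w) = r *\<^sub>R hprod p w"
  by (simp add: hprod_def scaleR_sum_right)

lemma hprod_mult_vec: "hprod (A *v p) w = hprod p (conj_transpose A *v w)"
proof -
  have "hprod (A *v p) w = (\<Sum>i\<in>UNIV. \<Sum>j\<in>UNIV. quat_cnj (p $ j) * quat_cnj (A $ i $ j) * w $ i)"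
    by (simp add: hprod_def matrix_vector_mult_def quat_cnj_sum quat_cnj_mult sum_distrib_right)
  also have "\<dots> = (\<Sum>j\<in>UNIV. \<Sum>i\<in>UNIV. quat_cnj (p $ j) * quat_cnj (A $ i $ j) * w $ i)"
    by (rule sum.swap)
  also have "\<dots> = hprod p (conj_transpose A *v w)"
    by (simp add: hprod_def matrix_vector_mult_def conj_transpose_def sum_distrib_left mult.assoc)
  finally show ?thesis .
qed

lemma hprod_self: "hprod v v = of_real ((norm v)\<^sup>2)"
proof -
  have "(norm v)\<^sup>2 = (\<Sum>i\<in>UNIV. (norm (v $ i))\<^sup>2)"
    by (simp add: power2_norm_eq_inner inner_vec_def)
  then show ?thesis by (simp add: hprod_def quat_cnj_mult_self)
qed

text \<open>Expresses the i component through the real inner product and the complex structure given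
  by right multiplication by i. Hence every orthogonal map commuting with that structure preserves
  it.\<close>

lemma qI_hprod: "qI (hprod p w) = inner (right_mult p (quat_of_complex \<i>)) w"
  unfolding qRe_hprod[symmetric] hprod_right_mult by simp

text \<open>An element of \<open>Sp_U1\<close> before restriction to the sphere. Being linear on the
  ambient space, it also describes the action on tangent vectors.\<close>

definition sp_u1_action :: "quat^'m^'m \<Rightarrow> quat \<Rightarrow> quat^'m \<Rightarrow> quat^'m" where
  "sp_u1_action A q v = right_mult (A *v v) q"

lemma right_mult_linear: "linear (\<lambda>v. right_mult v q)"
  by (rule linearI) (simp_all add: vec_eq_iff algebra_simps)

lemma quat_matrix_linear: "linear (\<lambda>v. A *v (v :: quat^'m))"
  by (rule linearI) (simp_all add: vec_eq_iff matrix_vector_mult_def algebra_simps sum.distrib scaleR_sum_right)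

lemma sp_u1_action_linear: "linear (sp_u1_action A q)"
proof -
  have "sp_u1_action A q = (\<lambda>v. right_mult v q) \<circ> (\<lambda>v. A *v v)"
    by (auto simp: sp_u1_action_def)
  then show ?thesis
    using linear_compose[OF quat_matrix_linear right_mult_linear] by metis
qed

text \<open>The unitary matrix cancels against its adjoint, and only conjugation by the right factor
  survives.\<close>

lemma hprod_sp_u1_action:
  assumes "A \<in> Sp"
  shows "hprod (sp_u1_action A q p) (sp_u1_action A q w) = quat_cnj q * hprod p w * q"
  using assms
  by (simp add: sp_u1_action_def hprod_right_mult hprod_mult_vec matrix_vector_mul_assoc Sp_def mult.assoc)

lemma inner_sp_u1_action:
  assumes "A \<in> Sp" "norm q = 1"
  shows "inner (sp_u1_action A q p) (sp_u1_action A q w) = inner p w"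
proof -
  have "qRe (quat_cnj q * h * q) = (norm q)\<^sup>2 * qRe h" for h
    unfolding quat_norm_sq by (simp add: algebra_simps power2_eq_square)
  then show ?thesis
    unfolding qRe_hprod[symmetric] hprod_sp_u1_action[OF assms(1)] by (simp add: assms)
qed

lemma norm_sp_u1_action:
  assumes "A \<in> Sp" "norm q = 1"
  shows "norm (sp_u1_action A q p) = norm p"
  by (simp add: norm_eq_sqrt_inner inner_sp_u1_action[OF assms])

lemma right_mult_right_mult: "right_mult (right_mult v p) q = right_mult v (p * q)"
  by (simp add: vec_eq_iff mult.assoc)

lemma matrix_right_mult: "A *v right_mult v q = right_mult (A *v v) q"
  by (simp add: vec_eq_iff matrix_vector_mult_def sum_distrib_right mult.assoc)

lemma right_mult_1 [simp]: "right_mult v 1 = v"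
  by (simp add: vec_eq_iff)

lemma sp_u1_action_inverse:
  assumes "A \<in> Sp" "norm q = 1"
  shows "sp_u1_action A q (sp_u1_action (conj_transpose A) (quat_cnj q) v) = v"
  using assms
  by (simp add: sp_u1_action_def matrix_right_mult right_mult_right_mult matrix_vector_mul_assoc
      unit_cnj_mult Sp_def)

section \<open>Isometries and the identity component\<close>

lemma smooth_on_imp_continuous_on:
  assumes "smooth_on A f"
  shows "continuous_on A f"
proof (rule continuous_on_eq_continuous_within[THEN iffD2, rule_format])
  fix x assume x: "x \<in> A"
  obtain U h where U: "open U" "x \<in> U" "C_on 0 U h" "\<And>y. y \<in> A \<inter> U \<Longrightarrow> h y = f y"
    using assms x unfolding smooth_on_def by metis
  have "continuous (at x within A) h"
    using U by (metis C_on.simps(1) continuous_at_imp_continuous_at_within continuous_on_eq_continuous_at)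
  moreover have "eventually (\<lambda>y. h y = f y) (at x within A)"
    using U eventually_at_topological by blast
  moreover have "h x = f x" using U x by blast
  ultimately show "continuous (at x within A) f"
    unfolding continuous_within using tendsto_cong[of h f "at x within A" "f x"] by simp
qed

lemma C_on_const: "C_on k U (\<lambda>x. c)"
  by (induction k arbitrary: c) auto

lemma C_on_linear:
  fixes f :: "'a::euclidean_space \<Rightarrow> 'b::euclidean_space"
  assumes "linear f"
  shows "C_on k U f"
proof -
  have d: "(f has_derivative f) (at x)" for x
    using assms linear_conv_bounded_linear bounded_linear_imp_has_derivative by blast
  have "frechet_derivative f (at x) = f" for x
    using d frechet_derivative_at by metis
  then show ?thesis
    using d by (cases k) (auto simp: C_on_const differentiable_def
        intro: linear_continuous_on linear_conv_bounded_linear[THEN iffD1, OF assms])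
qed

lemma smooth_on_linear:
  fixes f :: "'a::euclidean_space \<Rightarrow> 'b::euclidean_space"
  assumes "linear f" "\<And>x. x \<in> A \<Longrightarrow> g x = f x"
  shows "smooth_on A g"
  unfolding smooth_on_def
  by (intro ballI exI[of _ UNIV] exI[of _ f]) (use assms C_on_linear in auto)

text \<open>\<open>isometries\<close> only provides some derivative within the sphere; this
  identifies it on tangent vectors. Composition with a great circle reduces the claim to uniqueness
  of derivatives in one real variable.\<close>

lemma sphere_derivative_unique:
  fixes L :: "'a::euclidean_space \<Rightarrow> 'a"
  assumes L: "linear L" and eq: "\<And>x. x \<in> usphere \<Longrightarrow> \<phi> x = L x"
    and D: "(\<phi> has_derivative D) (at p within usphere)"
    and p: "p \<in> usphere" and v: "v \<in> tangent p"
  shows "D v = L v"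
proof -
  interpret D: linear D using D has_derivative_linear by blast
  have unit: "D u = L u" if u: "inner p u = 0" "norm u = 1" for u
  proof -
    \<comment> \<open>The great circle through \<open>p\<close> with velocity \<open>u\<close> at
      time 0.\<close>
    define c where "c = (\<lambda>t :: real. cos t *\<^sub>R p + sin t *\<^sub>R u)"
    have pp: "inner p p = 1" "inner u u = 1" "inner u p = 0"
      using p u by (simp_all add: norm_eq_1 inner_commute)
    have "inner (c t) (c t) = (cos t)\<^sup>2 + (sin t)\<^sup>2" for t
      by (simp add: c_def inner_simps pp u power2_eq_square)
    then have cs: "c t \<in> usphere" for t
      by (simp add: norm_eq_1)
    have c0: "c 0 = p" by (simp add: c_def)
    have c': "(c has_derivative (\<lambda>h. h *\<^sub>R u)) (at 0)"
      unfolding c_def by (auto intro!: derivative_eq_intros)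
    have "(\<phi> has_derivative D) (at (c 0) within c ` UNIV)"
      using D cs c0 has_derivative_subset by (metis image_subsetI)
    from diff_chain_within[OF c' this]
    have 1: "((\<phi> \<circ> c) has_derivative (D \<circ> (\<lambda>h. h *\<^sub>R u))) (at 0)" .
    have "(L has_derivative L) (at (c 0) within c ` UNIV)"
      using L linear_conv_bounded_linear bounded_linear_imp_has_derivative by blast
    from diff_chain_within[OF c' this]
    have "((L \<circ> c) has_derivative (L \<circ> (\<lambda>h. h *\<^sub>R u))) (at 0)" .
    moreover have "L \<circ> c = \<phi> \<circ> c" using eq cs by auto
    ultimately have "D \<circ> (\<lambda>h. h *\<^sub>R u) = L \<circ> (\<lambda>h. h *\<^sub>R u)"
      using 1 has_derivative_unique by metis
    then have "(D \<circ> (\<lambda>h. h *\<^sub>R u)) 1 = (L \<circ> (\<lambda>h. h *\<^sub>R u)) 1" by (rule arg_cong)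
    then show ?thesis by simp
  qed
  show ?thesis
  proof (cases "v = 0")
    case True then show ?thesis using L by (simp add: D.zero linear_0)
  next
    case False
    have "D (sgn v) = L (sgn v)"
      using v False by (intro unit) (auto simp: tangent_def sgn_div_norm)
    then have "norm v *\<^sub>R D (sgn v) = norm v *\<^sub>R L (sgn v)" by simp
    then show ?thesis
      using False L by (simp add: D.scale[symmetric] linear_scale[symmetric] sgn_div_norm)
  qed
qed

lemma isometries_linear_invariant:
  fixes L :: "'a::euclidean_space \<Rightarrow> 'a"
  assumes L: "linear L" and iso: "restrict L usphere \<in> isometries F"
    and p: "p \<in> usphere" and v: "v \<in> tangent p"
  shows "F (L p) (L v) = F p v"
proof -
  obtain D where D: "(restrict L usphere has_derivative D) (at p within usphere)"
    "F (restrict L usphere p) (D v) = F p v"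
    using iso p v unfolding isometries_def by blast
  have "D v = L v"
    by (rule sphere_derivative_unique[OF L _ D(1) p v]) simp
  with D(2) p show ?thesis by simp
qed

text \<open>A norm-preserving linear map keeps the sphere, is its own derivative there, and has the
  linear map \<open>L'\<close> as smooth inverse. This will produce isometries outside the given
  group.\<close>

lemma linear_in_isometries:
  fixes L L' :: "'a::euclidean_space \<Rightarrow> 'a"
  assumes L: "linear L" and L': "linear L'"
    and inv: "\<And>x. L (L' x) = x" "\<And>x. L' (L x) = x" and norm: "\<And>x. norm (L x) = norm x"
    and F: "\<And>p v. p \<in> usphere \<Longrightarrow> v \<in> tangent p \<Longrightarrow> F (L p) (L v) = F p v"
  shows "restrict L usphere \<in> isometries F"
proof -
  have norm': "norm (L' x) = norm x" for x using norm[of "L' x"] inv by simp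
  have bij: "bij_betw (restrict L usphere) usphere usphere"
    by (rule bij_betw_byWitness[where f' = L']) (auto simp: inv norm norm')
  have inv_into: "inv_into usphere (restrict L usphere) x = L' x" if "x \<in> usphere" for x
    using bij that by (intro inv_into_f_eq) (auto simp: bij_betw_def inv norm')
  have "(restrict L usphere has_derivative L) (at p within usphere)" if "p \<in> usphere" for p
  proof (rule has_derivative_transform[OF that])
    show "(L has_derivative L) (at p within usphere)"
      using L linear_conv_bounded_linear bounded_linear_imp_has_derivative by blast
  qed simp
  then have "\<exists>D. (restrict L usphere has_derivative D) (at p within usphere) \<and>
      (\<forall>v\<in>tangent p. F (restrict L usphere p) (D v) = F p v)" if "p \<in> usphere" for p
    using F that by (intro exI[of _ L]) simp
  moreover have "smooth_on usphere (restrict L usphere)" by (rule smooth_on_linear[OF L]) simp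
  moreover have "smooth_on usphere (inv_into usphere (restrict L usphere))"
    by (rule smooth_on_linear[OF L' inv_into])
  moreover have "restrict L usphere \<in> usphere \<rightarrow>\<^sub>E usphere" using norm by auto
  ultimately show ?thesis
    unfolding isometries_def mem_Collect_eq using bij by (intro conjI ballI) assumption+
qed

section \<open>The identity component in the compact-open topology\<close>

lemma isometries_continuous: "\<phi> \<in> isometries F \<Longrightarrow> continuous_on usphere \<phi>"
  by (auto simp: isometries_def intro: smooth_on_imp_continuous_on)

lemma identity_component_subset: "identity_component F \<subseteq> isometries F"
  unfolding identity_component_def
  using connected_component_of_subset_topspace[of "subtopology (compact_open_topology usphere) (isometries F)"]
  by (auto simp: topspace_subtopology)

text \<open>A bound on the velocity makes \<open>t \<mapsto> \<phi> t\<close> uniformly Lipschitz, hence continuous for the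
  compact-open topology.\<close>

lemma bounded_velocity_in_identity_component:
  fixes \<phi> :: "real \<Rightarrow> 'a::euclidean_space \<Rightarrow> 'a"
  assumes iso: "\<And>t. \<phi> t \<in> isometries F" and id: "\<And>p. p \<in> usphere \<Longrightarrow> \<phi> 0 p = p"
    and deriv: "\<And>p t. p \<in> usphere \<Longrightarrow> ((\<lambda>s. \<phi> s p) has_vector_derivative V t p) (at t)"
    and bound: "\<And>p t. p \<in> usphere \<Longrightarrow> norm (V t p) \<le> M"
  shows "\<phi> t \<in> identity_component F"
proof -
  let ?T = "compact_open_topology (usphere :: 'a set)"
  have lip: "norm (\<phi> s p - \<phi> t p) \<le> M * \<bar>s - t\<bar>" if "p \<in> usphere" for s t p
  proof -
    have "norm (\<phi> s p - \<phi> t p) \<le> M * norm (s - t)"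
    proof (rule differentiable_bound[where S = UNIV and f' = "\<lambda>t h. h *\<^sub>R V t p"])
      fix x :: real
      show "((\<lambda>s. \<phi> s p) has_derivative (\<lambda>h. h *\<^sub>R V x p)) (at x within UNIV)"
        using deriv[OF that, of x] by (simp add: has_vector_derivative_def)
      show "onorm (\<lambda>h. h *\<^sub>R V x p) \<le> M"
        using bound[OF that] by (intro onorm_le) (simp add: mult.commute[of M] mult_left_mono)
    qed auto
    then show ?thesis by simp
  qed
  have maps: "\<phi> t \<in> usphere \<rightarrow>\<^sub>E usphere" for t using iso by (auto simp: isometries_def)
  have cont: "continuous_on usphere (\<phi> t)" for t using iso isometries_continuous by blast
  \<comment> \<open>The subbasis generating the topology; continuity is tested on its members
    only.\<close>
  define B :: "('a \<Rightarrow> 'a) set set" where "B =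
     {{\<phi> \<in> usphere \<rightarrow>\<^sub>E usphere. continuous_on usphere \<phi> \<and> \<phi> ` K \<subseteq> U} | K U.
        compact K \<and> K \<subseteq> usphere \<and> open U}"
  have "continuous_map euclidean ?T \<phi>"
    unfolding compact_open_topology_def B_def[symmetric]
  proof (rule continuous_on_generated_topo)
    show "\<phi> ` topspace euclidean \<subseteq> \<Union> B"
    proof (rule image_subsetI)
      fix t
      let ?C = "{\<phi> \<in> usphere \<rightarrow>\<^sub>E usphere. continuous_on usphere \<phi> \<and> \<phi> ` {} \<subseteq> (UNIV :: 'a set)}"
      \<comment> \<open>The choice \<open>K = {}\<close> and \<open>U = UNIV\<close> imposes no
        condition beyond continuity, so this member contains every \<open>\<phi> t\<close>.\<close>
      have "?C \<in> B"
        unfolding B_def by (intro CollectI exI[of _ "{}"] exI[of _ UNIV]) simp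
      moreover have "\<phi> t \<in> ?C"
        using maps cont by blast
      ultimately show "\<phi> t \<in> \<Union> B" by (rule UnionI)
    qed
  next
    fix W assume "W \<in> B"
    then obtain K U where W: "W = {\<phi> \<in> usphere \<rightarrow>\<^sub>E usphere. continuous_on usphere \<phi> \<and> \<phi> ` K \<subseteq> U}"
      and K: "compact K" "K \<subseteq> usphere" and U: "open U" unfolding B_def by blast
    have "open {t. \<phi> t ` K \<subseteq> U}"
      unfolding open_dist
    proof safe
      fix t assume t: "\<phi> t ` K \<subseteq> U"
      \<comment> \<open>The compact image has an \<open>e\<close>-neighbourhood inside
        \<open>U\<close>, and the Lipschitz bound allows times within
        \<open>e / (\<bar>M\<bar> + 1)\<close>; the summand 1 keeps the divisor positive.\<close>
      have "compact (\<phi> t ` K)" using K cont continuous_on_subset compact_continuous_image by blast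
      then obtain e where e: "e > 0" "(\<Union>x\<in>\<phi> t ` K. ball x e) \<subseteq> U"
        using compact_subset_open_imp_ball_epsilon_subset[OF _ U t] by metis
      have M: "0 < \<bar>M\<bar> + 1" by simp
      show "\<exists>e>0. \<forall>s. dist s t < e \<longrightarrow> s \<in> {t. \<phi> t ` K \<subseteq> U}"
      proof (intro exI[of _ "e / (\<bar>M\<bar> + 1)"] conjI allI impI CollectI subsetI)
        show "0 < e / (\<bar>M\<bar> + 1)" using e M by simp
        fix s y assume s: "dist s t < e / (\<bar>M\<bar> + 1)" and "y \<in> \<phi> s ` K"
        then obtain x where x: "x \<in> K" "y = \<phi> s x" by blast
        have "norm (\<phi> s x - \<phi> t x) \<le> M * \<bar>s - t\<bar>" using lip x K by blast
        also have "\<dots> \<le> (\<bar>M\<bar> + 1) * \<bar>s - t\<bar>" by (intro mult_right_mono) auto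
        also have "\<dots> < e" using s M by (simp add: dist_real_def pos_less_divide_eq mult.commute)
        finally have "\<phi> s x \<in> ball (\<phi> t x) e" by (simp add: dist_norm norm_minus_commute)
        with e x show "y \<in> U" by blast
      qed
    qed
    moreover have "\<phi> -` W \<inter> topspace euclidean = {t. \<phi> t ` K \<subseteq> U}"
      using maps cont by (auto simp: W)
    ultimately show "openin euclidean (\<phi> -` W \<inter> topspace euclidean)" by simp
  qed
  then have "continuous_map euclidean (subtopology ?T (isometries F)) \<phi>"
    using iso by (auto simp: continuous_map_in_subtopology)
  then have "connectedin (subtopology ?T (isometries F)) (\<phi> ` UNIV)"
    by (rule connectedin_continuous_map_image) simp
  moreover have "\<phi> 0 = restrict id usphere"
  proof (rule extensionalityI[of _ usphere])
    show "\<phi> 0 \<in> extensional usphere" using maps[of 0] by (simp add: PiE_def)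
  qed (use id in auto)
  ultimately show ?thesis
    unfolding identity_component_def connected_component_of_set
    by (intro CollectI exI[of _ "\<phi> ` UNIV"]) (auto intro: range_eqI[where x = 0 and f = \<phi>, OF sym])
qed

text \<open>The field is continuous on the compact sphere, hence bounded, and so is the velocity of
  its flow. This places the flow in the group that is known explicitly.\<close>

lemma killing_flow_in_identity_component:
  assumes "killing_field F Y"
  obtains \<phi> where "\<And>t. \<phi> t \<in> identity_component F" "\<And>p. p \<in> usphere \<Longrightarrow> \<phi> 0 p = p"
    "\<And>p. p \<in> usphere \<Longrightarrow> ((\<lambda>s. \<phi> s p) has_vector_derivative Y p) (at 0)"
proof -
  obtain \<phi> where \<phi>: "\<And>t. \<phi> t \<in> isometries F" "\<And>p. p \<in> usphere \<Longrightarrow> \<phi> 0 p = p"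
    "\<And>p t. p \<in> usphere \<Longrightarrow> ((\<lambda>s. \<phi> s p) has_vector_derivative Y (\<phi> t p)) (at t)"
    and Y: "smooth_on usphere Y"
    using assms unfolding killing_field_def by blast
  have "compact (Y ` usphere)"
    using Y smooth_on_imp_continuous_on compact_continuous_image compact_sphere by blast
  then obtain M where M: "\<And>p. p \<in> usphere \<Longrightarrow> norm (Y p) \<le> M"
    by (meson bounded_iff compact_imp_bounded image_eqI)
  have "\<phi> t p \<in> usphere" if "p \<in> usphere" for t p
    using \<phi>(1)[of t] that by (auto simp: isometries_def)
  then have "\<phi> t \<in> identity_component F" for t
    using \<phi> M by (intro bounded_velocity_in_identity_component[where V = "\<lambda>t p. Y (\<phi> t p)" and M = M]) auto
  with \<phi>(2) \<phi>(3)[of _ 0] show ?thesis by (intro that[of \<phi>]) auto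
qed

section \<open>Forms invariant under the isotropy group\<close>

definition diag_matrix :: "('m \<Rightarrow> quat) \<Rightarrow> quat^'m^'m" where
  "diag_matrix d = (\<chi> i j. if i = j then d i else 0)"

lemma diag_matrix_mult_vec [simp]: "(diag_matrix d *v v) $ i = d i * v $ i"
  by (simp add: diag_matrix_def matrix_vector_mult_def if_distrib[of "\<lambda>x. x * _"] cong: if_cong)

lemma diag_matrix_Sp:
  assumes "\<And>i. norm (d i) = 1"
  shows "diag_matrix d \<in> Sp"
proof -
  have "conj_transpose (diag_matrix d) = diag_matrix (\<lambda>i. quat_cnj (d i))"
    by (auto simp: conj_transpose_def diag_matrix_def vec_eq_iff)
  moreover have "diag_matrix d ** diag_matrix d' = diag_matrix (\<lambda>i. d i * d' i)" for d d' :: "'a \<Rightarrow> quat"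
    by (simp add: vec_eq_iff diag_matrix_def matrix_matrix_mult_def if_distrib[of "\<lambda>x. x * _"]
        if_distrib[of "\<lambda>x. _ * x"] cong: if_cong)
  ultimately show ?thesis
    using assms unit_cnj_mult by (simp add: Sp_def) (simp add: diag_matrix_def mat_def)
qed

definition perm_matrix :: "('m \<Rightarrow> 'm) \<Rightarrow> quat^'m^'m" where
  "perm_matrix \<pi> = (\<chi> i j. if j = \<pi> i then 1 else 0)"

lemma perm_matrix_mult_vec [simp]: "(perm_matrix \<pi> *v v) $ i = v $ \<pi> i"
  by (simp add: perm_matrix_def matrix_vector_mult_def if_distrib[of "\<lambda>x. x * _"] cong: if_cong)

lemma involution_perm_matrix_Sp:
  assumes "\<And>i. \<pi> (\<pi> i) = i"
  shows "perm_matrix \<pi> \<in> Sp"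
proof -
  have "i = \<pi> j \<longleftrightarrow> j = \<pi> i" for i j using assms by metis
  then have "conj_transpose (perm_matrix \<pi>) = perm_matrix \<pi>"
    by (simp add: conj_transpose_def perm_matrix_def vec_eq_iff)
  moreover have "perm_matrix \<pi> ** perm_matrix \<pi> = mat 1"
    using assms by (auto simp add: vec_eq_iff perm_matrix_def matrix_matrix_mult_def mat_def
        if_distrib[of "\<lambda>x. x * _"] cong: if_cong)
  ultimately show ?thesis by (simp add: Sp_def)
qed

lemma U1_1: "1 \<in> U1"
  by (simp add: U1_iff)

lemma inner_axis_1_left: "inner (axis k 1) w = qRe (w $ k)"
  by (simp add: inner_axis' inner_quat_def)

text \<open>Only few isotropy elements at \<open>axis k 1\<close> are needed: unit quaternions acting on single
  coordinates, transpositions of coordinates, and conjugation by \<open>U(1)\<close> on the \<open>k\<close>-th coordinate.\<close>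

lemma isotropy_invariant_forms:
  fixes B :: "quat^'m \<Rightarrow> quat^'m \<Rightarrow> real" and b :: "quat^'m \<Rightarrow> real" and k l :: 'm
  assumes B: "bilinear B" and sym: "\<And>u v. B u v = B v u" and b: "linear b" and l: "l \<noteq> k"
    and invB: "\<And>A q v. A \<in> Sp \<Longrightarrow> q \<in> U1 \<Longrightarrow> sp_u1_action A q (axis k 1) = axis k 1 \<Longrightarrow>
      B (sp_u1_action A q v) (sp_u1_action A q v) = B v v"
    and invb: "\<And>A q v. A \<in> Sp \<Longrightarrow> q \<in> U1 \<Longrightarrow> sp_u1_action A q (axis k 1) = axis k 1 \<Longrightarrow>
      b (sp_u1_action A q v) = b v"
  obtains a\<^sub>h a\<^sub>i a\<^sub>j d where
    "\<And>w. qRe (w $ k) = 0 \<Longrightarrow> B w w = a\<^sub>h * ((norm w)\<^sup>2 - (norm (w $ k))\<^sup>2) + a\<^sub>i * (qI (w $ k))\<^sup>2 +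
      a\<^sub>j * ((qJ (w $ k))\<^sup>2 + (qK (w $ k))\<^sup>2)"
    "\<And>w. qRe (w $ k) = 0 \<Longrightarrow> b w = d * qI (w $ k)"
proof -
  interpret b: linear b by fact
  have Bl: "linear (\<lambda>u. B u v)" and Br: "linear (B v)" for v
    using B by (auto simp: bilinear_def)
  note Badd = bilinear_ladd[OF B] bilinear_radd[OF B] bilinear_lmul[OF B] bilinear_rmul[OF B]
    bilinear_lneg[OF B] bilinear_rneg[OF B]
  \<comment> \<open>Polarization of \<open>invB\<close>.\<close>
  have invB2: "B (sp_u1_action A q u) (sp_u1_action A q v) = B u v"
    if "A \<in> Sp" "q \<in> U1" "sp_u1_action A q (axis k 1) = axis k 1" for A q u v
  proof -
    have "sp_u1_action A q (u + v) = sp_u1_action A q u + sp_u1_action A q v"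
      by (rule linear_add[OF sp_u1_action_linear])
    with invB[OF that, of "u + v"] invB[OF that, of u] invB[OF that, of v] show ?thesis
      by (simp add: Badd sym[of "sp_u1_action A q v" "sp_u1_action A q u"] sym[of v u])
  qed
  let ?D = "\<lambda>j u. diag_matrix (\<lambda>i. if i = j then u else 1)"
  have act_ax: "sp_u1_action (diag_matrix f) q (axis j x) = axis j (f j * x * q)" for f q j x
    by (auto simp: vec_eq_iff sp_u1_action_def axis_def)
  have D_Sp: "?D j u \<in> Sp" if "norm u = 1" for j :: 'm and u
    using that by (intro diag_matrix_Sp) simp
  have norm1: "norm (-1 :: quat) = 1" by simp
  \<comment> \<open>A sign change in whichever of the two coordinates is not \<open>k\<close> fixes
    \<open>axis k 1\<close> and negates the mixed term.\<close>
  have cross: "B (axis j x) (axis j' y) = 0" if jj: "j \<noteq> j'" for j j' x y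
  proof (cases "j = k")
    case False
    have "B (sp_u1_action (?D j (-1)) 1 (axis j x)) (sp_u1_action (?D j (-1)) 1 (axis j' y)) =
      B (axis j x) (axis j' y)"
      using False by (intro invB2 D_Sp norm1 U1_1) (simp add: act_ax)
    moreover have "axis j (- x) = - axis j x" by (simp add: vec_eq_iff axis_def)
    ultimately show ?thesis using jj by (simp add: act_ax Badd)
  next
    case True
    have "B (sp_u1_action (?D j' (-1)) 1 (axis j x)) (sp_u1_action (?D j' (-1)) 1 (axis j' y)) =
      B (axis j x) (axis j' y)"
      using True jj by (intro invB2 D_Sp norm1 U1_1) (simp add: act_ax)
    moreover have "axis j' (- y) = - axis j' y" by (simp add: vec_eq_iff axis_def)
    ultimately show ?thesis using jj by (simp add: act_ax Badd)
  qed
  have b0: "b (axis j x) = 0" if "j \<noteq> k" for j x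
  proof -
    have "b (sp_u1_action (?D j (-1)) 1 (axis j x)) = b (axis j x)"
      using that by (intro invb D_Sp norm1 U1_1) (simp add: act_ax)
    moreover have "axis j (- x) = - axis j x" by (simp add: vec_eq_iff axis_def)
    ultimately show ?thesis by (simp add: act_ax b.neg)
  qed
  have axis_scale: "axis j (r *\<^sub>R x) = r *\<^sub>R axis j x" for j and r and x :: quat
    by (simp add: vec_eq_iff axis_def)
  have axis_add: "axis j (x + y) = axis j x + axis j y" for j and x y :: quat
    by (simp add: vec_eq_iff axis_def)
  \<comment> \<open>Left multiplication of coordinate \<open>j\<close> by the unit quaternion
    \<open>?u\<close> carries \<open>axis j 1\<close> to \<open>axis j ?u\<close>.\<close>
  have diag1: "B (axis j x) (axis j x) = (norm x)\<^sup>2 * B (axis j 1) (axis j 1)" if "j \<noteq> k" for j x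
  proof (cases "x = 0")
    case True
    then have "axis j x = 0 *\<^sub>R axis j 1" by (simp add: vec_eq_iff axis_def)
    then show ?thesis by (simp only: Badd True) simp
  next
    case False
    let ?u = "x /\<^sub>R norm x"
    have "B (sp_u1_action (?D j ?u) 1 (axis j 1)) (sp_u1_action (?D j ?u) 1 (axis j 1)) =
      B (axis j 1) (axis j 1)"
      using that False by (intro invB2 D_Sp U1_1) (simp_all add: act_ax)
    then have "B (axis j ?u) (axis j ?u) = B (axis j 1) (axis j 1)" by (simp add: act_ax)
    moreover have "axis j x = norm x *\<^sub>R axis j ?u"
      using False by (simp add: axis_scale[symmetric])
    ultimately show ?thesis by (simp only: Badd real_scaleR_def power2_eq_square mult.assoc)
  qed
  \<comment> \<open>The transposition of \<open>j\<close> and \<open>l\<close> leaves coordinate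
    \<open>k\<close> alone, so it lies in the isotropy group.\<close>
  have diag2: "B (axis j 1) (axis j 1) = B (axis l 1) (axis l 1)" if "j \<noteq> k" for j
  proof -
    let ?\<pi> = "\<lambda>i. if i = j then l else if i = l then j else i"
    have act: "sp_u1_action (perm_matrix ?\<pi>) 1 v $ i = v $ ?\<pi> i" for v i
      by (simp add: sp_u1_action_def)
    have "B (sp_u1_action (perm_matrix ?\<pi>) 1 (axis l 1)) (sp_u1_action (perm_matrix ?\<pi>) 1 (axis l 1)) =
      B (axis l 1) (axis l 1)"
      using that l by (intro invB2 U1_1 involution_perm_matrix_Sp)
        (auto simp add: vec_eq_iff act axis_def)
    moreover have "sp_u1_action (perm_matrix ?\<pi>) 1 (axis l 1) = axis j 1"
      using that l by (auto simp add: vec_eq_iff act axis_def)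
    ultimately show ?thesis by simp
  qed
  let ?i = "Quat 0 1 0 0" and ?j = "Quat 0 0 1 0" and ?k = "Quat 0 0 0 1"
  \<comment> \<open>The left factor on coordinate \<open>k\<close> undoes the right factor
    \<open>q\<close> on \<open>axis k 1\<close>, so the isotropy group conjugates the
    \<open>k\<close>-th coordinate by U(1).\<close>
  have conj_ax: "sp_u1_action (?D k (quat_cnj q)) q (axis k x) = axis k (quat_cnj q * x * q)" for q x
    by (simp add: act_ax)
  have invk: "B (axis k (quat_cnj q * x * q)) (axis k (quat_cnj q * y * q)) = B (axis k x) (axis k y)"
    "b (axis k (quat_cnj q * x * q)) = b (axis k x)" if "q \<in> U1" for q x y
  proof -
    have q: "norm q = 1" "norm (quat_cnj q) = 1" using U1_norm that by simp_all
    then have fixk: "sp_u1_action (?D k (quat_cnj q)) q (axis k 1) = axis k 1"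
      by (simp add: conj_ax unit_cnj_mult)
    show "B (axis k (quat_cnj q * x * q)) (axis k (quat_cnj q * y * q)) = B (axis k x) (axis k y)"
      using invB2[OF D_Sp[OF q(2)] that fixk, of "axis k x" "axis k y"] by (simp only: conj_ax)
    show "b (axis k (quat_cnj q * x * q)) = b (axis k x)"
      using invb[OF D_Sp[OF q(2)] that fixk, of "axis k x"] by (simp only: conj_ax)
  qed
  have axis_neg: "axis k (Quat 0 0 (-1) 0) = - axis k ?j" "axis k (Quat 0 0 0 (-1)) = - axis k ?k"
    by (simp_all add: vec_eq_iff axis_def quat_eq_iff)
  have iU: "?i \<in> U1" by (simp add: U1_iff)
  \<comment> \<open>Conjugation by i fixes i and negates j and k, which kills the mixed terms of i
    with j and k and the form \<open>b\<close> on j and k.\<close>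
  have conj_i: "quat_cnj ?i * ?i * ?i = ?i" "quat_cnj ?i * ?j * ?i = Quat 0 0 (-1) 0"
    "quat_cnj ?i * ?k * ?i = Quat 0 0 0 (-1)" by (simp_all add: quat_eq_iff)
  have bi: "B (axis k ?i) (axis k ?j) = 0" "B (axis k ?i) (axis k ?k) = 0"
    "b (axis k ?j) = 0" "b (axis k ?k) = 0"
    using invk(1)[OF iU, of ?i ?j] invk(1)[OF iU, of ?i ?k] invk(2)[OF iU, of ?j] invk(2)[OF iU, of ?k]
    unfolding conj_i axis_neg Badd b.neg by simp_all
  \<comment> \<open>An eighth root of unity: conjugation by it is a quarter turn of the plane of j
    and k, so \<open>B\<close> is a multiple of the standard form there.\<close>
  define s where "s = Quat (sqrt (1/2)) (sqrt (1/2)) 0 0"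
  have sq: "sqrt (1/2) * sqrt (1/2) = 1/2" by simp
  have sU: "s \<in> U1" by (simp add: U1_iff s_def)
  have conj_s: "quat_cnj s * ?j * s = Quat 0 0 0 (-1)" "quat_cnj s * ?k * s = ?j"
    by (simp_all add: s_def quat_eq_iff sq)
  have bj: "B (axis k ?k) (axis k ?k) = B (axis k ?j) (axis k ?j)" "B (axis k ?j) (axis k ?k) = 0"
    using invk(1)[OF sU, of ?k ?k] invk(1)[OF sU, of ?j ?k] sym[of "axis k ?k" "axis k ?j"]
    unfolding conj_s axis_neg Badd by simp_all
  have im: "axis k x = qI x *\<^sub>R axis k ?i + qJ x *\<^sub>R axis k ?j + qK x *\<^sub>R axis k ?k" if "qRe x = 0" for x
    using that by (simp add: vec_eq_iff axis_def quat_eq_iff)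
  have Bk: "B (axis k x) (axis k x) = B (axis k ?i) (axis k ?i) * (qI x)\<^sup>2 +
      B (axis k ?j) (axis k ?j) * ((qJ x)\<^sup>2 + (qK x)\<^sup>2)" if "qRe x = 0" for x
    using sym[of "axis k ?j" "axis k ?i"] sym[of "axis k ?k" "axis k ?j"] sym[of "axis k ?k" "axis k ?i"]
    by (subst (1 2) im[OF that]) (simp add: Badd bi bj power2_eq_square algebra_simps)
  have bk: "b (axis k x) = b (axis k ?i) * qI x" if "qRe x = 0" for x
    by (subst im[OF that]) (simp add: b.add b.scale bi)
  have expand: "w = (\<Sum>j\<in>UNIV. axis j (w $ j))" for w :: "quat^'m"
    by (simp add: vec_eq_iff axis_def)
  have Bsum: "B w w = (\<Sum>j\<in>UNIV. B (axis j (w $ j)) (axis j (w $ j)))" for w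
  proof -
    have "B w w = (\<Sum>j\<in>UNIV. \<Sum>j'\<in>UNIV. B (axis j' (w $ j')) (axis j (w $ j)))"
      by (subst (1 2) expand) (simp only: linear_sum[OF Bl] linear_sum[OF Br] o_def)
    also have "\<dots> = (\<Sum>j\<in>UNIV. \<Sum>j'\<in>UNIV. if j' = j then B (axis j (w $ j)) (axis j (w $ j)) else 0)"
      using cross by (intro sum.cong refl) auto
    finally show ?thesis by simp
  qed
  have nsum: "(norm w)\<^sup>2 = (\<Sum>j\<in>UNIV. (norm (w $ j))\<^sup>2)" for w :: "quat^'m"
    by (simp add: power2_norm_eq_inner inner_vec_def)
  show thesis
  proof (rule that[of "B (axis l 1) (axis l 1)" "B (axis k ?i) (axis k ?i)" "B (axis k ?j) (axis k ?j)" "b (axis k ?i)"])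
    fix w :: "quat^'m" assume w: "qRe (w $ k) = 0"
    have "(\<Sum>j\<in>UNIV - {k}. B (axis j (w $ j)) (axis j (w $ j))) =
        (\<Sum>j\<in>UNIV - {k}. B (axis l 1) (axis l 1) * (norm (w $ j))\<^sup>2)"
      by (intro sum.cong refl) (metis DiffD2 diag1 diag2 insertI1 mult.commute)
    moreover have "(norm w)\<^sup>2 - (norm (w $ k))\<^sup>2 = (\<Sum>j\<in>UNIV - {k}. (norm (w $ j))\<^sup>2)"
      unfolding nsum by (simp add: sum_diff1)
    ultimately show "B w w = B (axis l 1) (axis l 1) * ((norm w)\<^sup>2 - (norm (w $ k))\<^sup>2) +
       B (axis k ?i) (axis k ?i) * (qI (w $ k))\<^sup>2 +
       B (axis k ?j) (axis k ?j) * ((qJ (w $ k))\<^sup>2 + (qK (w $ k))\<^sup>2)"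
      unfolding Bsum[of w] by (subst sum.remove[of _ k]) (simp_all add: Bk[OF w] sum_distrib_left)
    have "(\<Sum>j\<in>UNIV - {k}. b (axis j (w $ j))) = 0" by (intro sum.neutral) (use b0 in auto)
    then show "b w = b (axis k ?i) * qI (w $ k)"
      by (subst expand, unfold b.sum, subst sum.remove[of _ k]) (simp_all add: bk[OF w])
  qed
qed

section \<open>The normal form of an invariant Randers metric\<close>

lemma sp_u1_action_in_Sp_U1:
  "A \<in> Sp \<Longrightarrow> q \<in> U1 \<Longrightarrow> restrict (sp_u1_action A q) usphere \<in> Sp_U1"
  unfolding Sp_U1_def sp_u1_action_def by blast

lemma sp_u1_action_invariant:
  assumes "identity_component F = Sp_U1" "A \<in> Sp" "q \<in> U1" "p \<in> usphere" "v \<in> tangent p"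
  shows "F (sp_u1_action A q p) (sp_u1_action A q v) = F p v"
proof (rule isometries_linear_invariant[OF sp_u1_action_linear])
  show "restrict (sp_u1_action A q) usphere \<in> isometries F"
    using sp_u1_action_in_Sp_U1[OF assms(2,3)] identity_component_subset assms(1) by blast
qed (use assms in auto)

text \<open>U(1) commutes with i and rotates only the plane of j and k.\<close>

lemma qI_U1_conj: "q \<in> U1 \<Longrightarrow> qI (quat_cnj q * h * q) = qI h"
proof -
  assume q: "q \<in> U1"
  have "qJ q = 0" "qK q = 0" using q by (simp_all add: U1_iff)
  then have "qI (quat_cnj q * h * q) = ((qRe q)\<^sup>2 + (qI q)\<^sup>2) * qI h"
    by (simp add: algebra_simps power2_eq_square)
  then show ?thesis using q by (simp add: U1_iff)
qed

lemma qJK_norm: "(qJ h)\<^sup>2 + (qK h)\<^sup>2 = (norm h)\<^sup>2 - (qRe h)\<^sup>2 - (qI h)\<^sup>2"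
  by (simp add: quat_norm_sq)

text \<open>A Berger metric plus an invariant one-form. For unit \<open>p\<close> the factor of
  \<open>a\<close> is the squared length of the part of \<open>w\<close> orthogonal to
  \<open>p\<close> over the quaternions. The real part of \<open>h\<close> has no weight of its own,
  as it vanishes on tangent vectors.\<close>

definition berger_randers ::
    "real \<Rightarrow> real \<Rightarrow> real \<Rightarrow> real \<Rightarrow> quat^'m \<Rightarrow> quat^'m \<Rightarrow> real" where
  "berger_randers a b c d p w = (let h = hprod p w in
     sqrt (a * ((norm w)\<^sup>2 - (norm h)\<^sup>2) + b * (qI h)\<^sup>2 + c * ((qJ h)\<^sup>2 + (qK h)\<^sup>2)) + d * qI h)"

lemma berger_randers_invariant:
  assumes A: "A \<in> Sp" and q: "q \<in> U1"
  shows "berger_randers a b c d (sp_u1_action A q p) (sp_u1_action A q w) = berger_randers a b c d p w"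
proof -
  have "qRe (quat_cnj q * hprod p w * q) = qRe (hprod p w)"
    using inner_sp_u1_action[OF A U1_norm[OF q]] unfolding qRe_hprod[symmetric] hprod_sp_u1_action[OF A] by metis
  then show ?thesis
    unfolding berger_randers_def Let_def hprod_sp_u1_action[OF A] qJK_norm qI_U1_conj[OF q]
      norm_sp_u1_action[OF A U1_norm[OF q]]
    by (simp only: quat_norm_mult quat_norm_cnj U1_norm[OF q] mult_1_left mult_1_right)
qed

lemma hprod_axis: "hprod (axis k h) w = quat_cnj h * w $ k"
  by (simp add: hprod_def axis_def if_distrib[of quat_cnj] if_distrib[of "\<lambda>x. x * _"] cong: if_cong)

lemma hprod_axis_1: "hprod (axis k 1) w = w $ k"
  by (simp add: hprod_axis)

lemma norm_axis: "norm (axis k (x :: 'a::real_inner)) = norm x"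
  by (simp add: norm_eq_sqrt_inner inner_axis_axis)

lemma axis_1_usphere: "axis k (1 :: quat) \<in> usphere"
  by (simp add: norm_axis)

text \<open>Comparing \<open>F\<close> at \<open>v\<close> and \<open>- v\<close> separates the norm
  from the one-form, so both are invariant under the isotropy group and the classification of
  invariant forms applies.\<close>

lemma invariant_randers_at_axis:
  fixes F :: "quat^'m \<Rightarrow> quat^'m \<Rightarrow> real"
  assumes rd: "randers_decomposition F g \<beta>" and comp: "identity_component F = Sp_U1" and l: "l \<noteq> k"
  obtains a b c d where
    "\<And>w. w \<in> tangent (axis k 1) \<Longrightarrow> F (axis k 1) w = berger_randers a b c d (axis k 1) w"
proof -
  let ?e = "axis k 1 :: quat^'m"
  \<comment> \<open>Orthogonal projection to the tangent space; it extends \<open>g\<close> and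
    \<open>\<beta>\<close> to forms on the whole ambient space and commutes with the isotropy
    action.\<close>
  define P where "P = (\<lambda>u. u - inner ?e u *\<^sub>R ?e)"
  have e: "?e \<in> usphere" by (rule axis_1_usphere)
  have ee: "inner ?e ?e = 1" using e by (simp add: norm_eq_1)
  have Pt: "P u \<in> tangent ?e" for u
    by (simp add: P_def tangent_def inner_diff_right ee)
  have Padd: "P (u + v) = P u + P v" and Pscale: "P (r *\<^sub>R u) = r *\<^sub>R P u" for u v r
    by (simp_all add: P_def inner_add_right algebra_simps)
  have P_id: "P u = u" if "u \<in> tangent ?e" for u using that by (simp add: P_def tangent_def)
  have gsym: "g ?e u v = g ?e v u" if "u \<in> tangent ?e" "v \<in> tangent ?e" for u v
    using rd that e unfolding randers_decomposition_def riemannian_metric_def by blast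
  have glin: "g ?e (x *\<^sub>R u + y *\<^sub>R v) w = x * g ?e u w + y * g ?e v w"
    if "u \<in> tangent ?e" "v \<in> tangent ?e" "w \<in> tangent ?e" for u v w x y
    using rd that e unfolding randers_decomposition_def riemannian_metric_def by blast
  have \<beta>lin: "\<beta> ?e (x *\<^sub>R u + y *\<^sub>R v) = x * \<beta> ?e u + y * \<beta> ?e v"
    if "u \<in> tangent ?e" "v \<in> tangent ?e" for u v x y
    using rd that e unfolding randers_decomposition_def one_form_def by blast
  have F: "F ?e v = sqrt (g ?e v v) + \<beta> ?e v" if "v \<in> tangent ?e" for v
    using rd that e unfolding randers_decomposition_def by blast
  define B where "B = (\<lambda>u v. g ?e (P u) (P v))"
  define b where "b = (\<lambda>u. \<beta> ?e (P u))"
  have Bsym: "B u v = B v u" for u v unfolding B_def by (rule gsym[OF Pt Pt])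
  have B1: "linear (\<lambda>u. B u v)" for v
  proof (rule linearI)
    fix u1 u2 and r
    show "B (u1 + u2) v = B u1 v + B u2 v"
      using glin[OF Pt Pt Pt, of 1 u1 1 u2 v] by (simp add: B_def Padd)
    show "B (r *\<^sub>R u1) v = r *\<^sub>R B u1 v"
      using glin[OF Pt Pt Pt, of r u1 0 u1 v] by (simp add: B_def Pscale)
  qed
  have "B u = (\<lambda>v. B v u)" for u using Bsym by blast
  with B1 have B: "bilinear B" unfolding bilinear_def by metis
  have b: "linear b"
  proof (rule linearI)
    fix u1 u2 and r
    show "b (u1 + u2) = b u1 + b u2"
      using \<beta>lin[OF Pt Pt, of 1 u1 1 u2] by (simp add: b_def Padd)
    show "b (r *\<^sub>R u1) = r *\<^sub>R b u1"
      using \<beta>lin[OF Pt Pt, of r u1 0 u1] by (simp add: b_def Pscale)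
  qed
  have F': "F ?e (P v) = sqrt (B v v) + b v" for v unfolding B_def b_def by (rule F[OF Pt])
  have inv: "B (sp_u1_action A q v) (sp_u1_action A q v) = B v v \<and> b (sp_u1_action A q v) = b v"
    if A: "A \<in> Sp" and q: "q \<in> U1" and fixe: "sp_u1_action A q ?e = ?e" for A q v
  proof -
    let ?L = "sp_u1_action A q"
    have L: "linear ?L" by (rule sp_u1_action_linear)
    have "inner ?e (?L v) = inner ?e v" for v
      using inner_sp_u1_action[OF A U1_norm[OF q], of ?e v] by (simp only: fixe)
    then have LP: "P (?L v) = ?L (P v)" for v
      unfolding P_def by (simp only: linear_diff[OF L] linear_scale[OF L] fixe)
    have FL: "F ?e (P (?L v)) = F ?e (P v)" for v
      using sp_u1_action_invariant[OF comp A q e Pt[of v]] by (simp only: fixe LP)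
    have m: "?L (- v) = - ?L v" by (rule linear_neg[OF L])
    \<comment> \<open>Half the sum and half the difference of the two equations give the separate
      invariances.\<close>
    have "sqrt (B (?L v) (?L v)) + b (?L v) = sqrt (B v v) + b v"
      "sqrt (B (?L v) (?L v)) - b (?L v) = sqrt (B v v) - b v"
      using FL[of v] FL[of "- v"]
      unfolding F' m bilinear_lneg[OF B] bilinear_rneg[OF B] linear_neg[OF b] minus_minus
      by (simp_all only: diff_conv_add_uminus)
    then have "sqrt (B (?L v) (?L v)) = sqrt (B v v) \<and> b (?L v) = b v" by linarith
    then show ?thesis unfolding real_sqrt_eq_iff .
  qed
  show thesis
  proof (rule isotropy_invariant_forms[OF B Bsym b l])
    fix A :: "quat^'m^'m" and q v
    assume "A \<in> Sp" "q \<in> U1" "sp_u1_action A q ?e = ?e"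
    from inv[OF this, of v] show "B (sp_u1_action A q v) (sp_u1_action A q v) = B v v"
      "b (sp_u1_action A q v) = b v" by simp_all
  next
    fix a\<^sub>h a\<^sub>i a\<^sub>j d
    assume Bf: "\<And>w. qRe (w $ k) = 0 \<Longrightarrow> B w w = a\<^sub>h * ((norm w)\<^sup>2 - (norm (w $ k))\<^sup>2) + a\<^sub>i * (qI (w $ k))\<^sup>2 +
      a\<^sub>j * ((qJ (w $ k))\<^sup>2 + (qK (w $ k))\<^sup>2)"
      and bf: "\<And>w. qRe (w $ k) = 0 \<Longrightarrow> b w = d * qI (w $ k)"
    show thesis
    proof (rule that[of a\<^sub>h a\<^sub>i a\<^sub>j d])
      fix w assume w: "w \<in> tangent ?e"
      then have "qRe (w $ k) = 0" by (simp add: tangent_def inner_axis_1_left)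
      then show "F ?e w = berger_randers a\<^sub>h a\<^sub>i a\<^sub>j d ?e w"
        using F'[of w] Bf[of w] bf[of w] by (simp add: P_id w berger_randers_def Let_def hprod_axis_1)
    qed
  qed
qed

text \<open>Homogeneity provides a group element moving \<open>axis k 1\<close> to \<open>p\<close>;
  both sides are invariant under it, so the formula at one point spreads to the sphere.\<close>

lemma invariant_randers_normal_form:
  fixes F :: "quat^'m \<Rightarrow> quat^'m \<Rightarrow> real" and k l :: 'm
  assumes rd: "randers_decomposition F g \<beta>" and comp: "identity_component F = Sp_U1"
    and hom: "homogeneous_metric F" and l: "l \<noteq> k"
  obtains a b c d where
    "\<And>p w. p \<in> usphere \<Longrightarrow> w \<in> tangent p \<Longrightarrow> F p w = berger_randers a b c d p w"
proof -
  let ?e = "axis k 1 :: quat^'m"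
  obtain a b c d where abcd: "\<And>w. w \<in> tangent ?e \<Longrightarrow> F ?e w = berger_randers a b c d ?e w"
    by (rule invariant_randers_at_axis[OF rd comp l]) blast
  show thesis
  proof (rule that[of a b c d])
    fix p w :: "quat^'m" assume p: "p \<in> usphere" and w: "w \<in> tangent p"
    obtain \<phi> where \<phi>: "\<phi> \<in> Sp_U1" "\<phi> ?e = p"
      using hom p axis_1_usphere comp unfolding homogeneous_metric_def by metis
    then obtain A q where A: "A \<in> Sp" and q: "q \<in> U1" and \<phi>_eq: "\<phi> = restrict (sp_u1_action A q) usphere"
      unfolding Sp_U1_def sp_u1_action_def by blast
    have pe: "sp_u1_action A q ?e = p"
      using \<phi>(2) unfolding \<phi>_eq restrict_apply'[OF axis_1_usphere] .
    obtain w0 where w0: "sp_u1_action A q w0 = w"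
      using sp_u1_action_inverse[OF A U1_norm[OF q]] by blast
    have t: "w0 \<in> tangent ?e"
      using w inner_sp_u1_action[OF A U1_norm[OF q], of ?e w0] by (simp add: tangent_def w0 pe)
    have "F p w = F ?e w0"
      using sp_u1_action_invariant[OF comp A q axis_1_usphere t] by (simp only: w0 pe)
    also have "\<dots> = berger_randers a b c d p w"
      using berger_randers_invariant[OF A q, of a b c d ?e w0] abcd[OF t] by (simp only: w0 pe)
    finally show "F p w = berger_randers a b c d p w" .
  qed
qed

section \<open>Killing vector fields\<close>

lemma right_mult_bounded_bilinear:
  "bounded_bilinear (right_mult :: quat^'m \<Rightarrow> quat \<Rightarrow> quat^'m)"
proof -
  have "linear (right_mult v)" for v :: "quat^'m"
    by (rule linearI) (simp_all add: vec_eq_iff algebra_simps)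
  then have "bilinear (right_mult :: quat^'m \<Rightarrow> quat \<Rightarrow> quat^'m)"
    unfolding bilinear_def using right_mult_linear by blast
  then show ?thesis by (simp add: bilinear_conv_bounded_bilinear)
qed

lemma quat_has_vector_derivative:
  assumes "((\<lambda>t. f1 t) has_real_derivative d1) (at x)" "((\<lambda>t. f2 t) has_real_derivative d2) (at x)"
    "((\<lambda>t. f3 t) has_real_derivative d3) (at x)" "((\<lambda>t. f4 t) has_real_derivative d4) (at x)"
  shows "((\<lambda>t. Quat (f1 t) (f2 t) (f3 t) (f4 t)) has_vector_derivative Quat d1 d2 d3 d4) (at x)"
proof -
  have eq: "Quat p q r s = p *\<^sub>R 1 + q *\<^sub>R Quat 0 1 0 0 + r *\<^sub>R Quat 0 0 1 0 + s *\<^sub>R Quat 0 0 0 1"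
    for p q r s by (simp add: quat_eq_iff)
  have "((\<lambda>t. f t *\<^sub>R e) has_vector_derivative d *\<^sub>R e) (at x)"
    if "(f has_real_derivative d) (at x)" for f d and e :: quat
    using has_vector_derivative_scaleR[OF that has_vector_derivative_const[of e]] by simp
  from has_vector_derivative_add[OF has_vector_derivative_add[OF has_vector_derivative_add[OF
        this[OF assms(1), of 1] this[OF assms(2), of "Quat 0 1 0 0"]]
        this[OF assms(3), of "Quat 0 0 1 0"]] this[OF assms(4), of "Quat 0 0 0 1"]]
  show ?thesis
    unfolding eq[symmetric] .
qed

text \<open>The pair \<open>A\<close>, \<open>q\<close> is determined by the map only up to a common
  sign, but the images of the \<open>axis l 1\<close> and conjugation by \<open>q\<close> do not see
  that sign.\<close>

lemma sp_u1_action_columns: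
  "sp_u1_action A q v = (\<Sum>l\<in>UNIV. right_mult (sp_u1_action A q (axis l 1)) (quat_cnj q * v $ l * q))"
  if "norm q = 1"
proof -
  have "v = (\<Sum>l\<in>UNIV. right_mult (axis l 1) (v $ l))"
    by (simp add: vec_eq_iff axis_def if_distrib[of "\<lambda>x. x * _"] cong: if_cong)
  then have "A *v v = (\<Sum>l\<in>UNIV. right_mult (A *v axis l 1) (v $ l))"
    by (metis (no_types, lifting) linear_sum[OF quat_matrix_linear] matrix_right_mult sum.cong)
  then have "sp_u1_action A q v = (\<Sum>l\<in>UNIV. right_mult (right_mult (A *v axis l 1) (v $ l)) q)"
    unfolding sp_u1_action_def by (simp only: linear_sum[OF right_mult_linear])
  moreover have "q * (quat_cnj q * v $ l * q) = v $ l * q" for l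
    using unit_cnj_mult(2)[OF that] by (metis mult.assoc mult_1_left)
  ultimately show ?thesis
    unfolding sp_u1_action_def by (simp only: right_mult_right_mult)
qed

text \<open>Conjugation by \<open>q \<in> U(1)\<close> depends on \<open>q\<close> only through \<open>q\<^sup>2\<close>, which can be read off from the
  action on \<open>axis k 1\<close> and \<open>axis k \<j>\<close>.\<close>

lemma U1_conj_eq:
  assumes "q \<in> U1"
  shows "quat_cnj q * h * q = Quat (qRe h) (qI h)
    (((qRe q)\<^sup>2 - (qI q)\<^sup>2) * qJ h + 2 * qRe q * qI q * qK h)
    (((qRe q)\<^sup>2 - (qI q)\<^sup>2) * qK h - 2 * qRe q * qI q * qJ h)"
proof -
  have q: "qJ q = 0" "qK q = 0" "(qRe q)\<^sup>2 + (qI q)\<^sup>2 = 1" using assms by (auto simp: U1_iff)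
  have "qRe (quat_cnj q * h * q) = ((qRe q)\<^sup>2 + (qI q)\<^sup>2) * qRe h"
    "qI (quat_cnj q * h * q) = ((qRe q)\<^sup>2 + (qI q)\<^sup>2) * qI h"
    using q(1,2) by (simp_all add: algebra_simps power2_eq_square)
  then show ?thesis
    using q(1,2) unfolding q(3) by (simp add: quat_eq_iff) (simp add: algebra_simps power2_eq_square)
qed

text \<open>The representatives \<open>A t\<close> and \<open>q t\<close> are chosen separately for
  each \<open>t\<close> and need not be continuous. Therefore only quantities recoverable from
  \<open>\<phi> t\<close> are differentiated: the columns and the square of
  \<open>q t\<close>.\<close>

lemma Sp_U1_curve_derivative:
  fixes Y :: "quat^'m \<Rightarrow> quat^'m" and \<phi> :: "real \<Rightarrow> quat^'m \<Rightarrow> quat^'m"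
  assumes \<phi>: "\<And>t. \<phi> t \<in> Sp_U1" and id: "\<And>p. p \<in> usphere \<Longrightarrow> \<phi> 0 p = p"
    and deriv: "\<And>p. p \<in> usphere \<Longrightarrow> ((\<lambda>s. \<phi> s p) has_vector_derivative Y p) (at 0)"
  shows "\<exists>X x. \<forall>v\<in>usphere. Y v = generated_field (X, x) v"
proof -
  have "\<exists>A q. A \<in> Sp \<and> q \<in> U1 \<and> \<phi> t = restrict (sp_u1_action A q) usphere" for t
    using \<phi>[of t] unfolding Sp_U1_def sp_u1_action_def by blast
  then obtain A q where A: "\<And>t. A t \<in> Sp" and q: "\<And>t. q t \<in> U1"
    and \<phi>_eq: "\<And>t. \<phi> t = restrict (sp_u1_action (A t) (q t)) usphere" by metis
  have \<phi>_app: "\<phi> t v = sp_u1_action (A t) (q t) v" if "v \<in> usphere" for t v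
    using that unfolding \<phi>_eq by simp
  obtain k :: 'm where "True" by blast
  let ?j = "Quat 0 0 1 0" and ?k = "Quat 0 0 0 1"
  \<comment> \<open>\<open>\<gamma>\<close> and \<open>\<sigma>\<close> are the real and imaginary
    parts of the square of \<open>q t\<close>.\<close>
  define \<gamma> where "\<gamma> = (\<lambda>t. (qRe (q t))\<^sup>2 - (qI (q t))\<^sup>2)"
  define \<sigma> where "\<sigma> = (\<lambda>t. 2 * qRe (q t) * qI (q t))"
  have ax: "axis l (1 :: quat) \<in> usphere" "axis l ?j \<in> usphere" for l :: 'm
    by (simp_all add: norm_axis norm_quat_def)
  have \<gamma>\<sigma>1: "(\<gamma> t)\<^sup>2 + (\<sigma> t)\<^sup>2 = 1" for t
  proof -
    have "(\<gamma> t)\<^sup>2 + (\<sigma> t)\<^sup>2 = ((qRe (q t))\<^sup>2 + (qI (q t))\<^sup>2)\<^sup>2"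
      by (simp add: \<gamma>_def \<sigma>_def power2_eq_square algebra_simps)
    then show ?thesis using q[of t] by (simp add: U1_iff)
  qed
  have hp: "hprod (\<phi> t (axis k 1)) (\<phi> t (axis k ?j)) = Quat 0 0 (\<gamma> t) (- \<sigma> t)" for t
    unfolding \<phi>_app[OF ax(1)] \<phi>_app[OF ax(2)] hprod_sp_u1_action[OF A] hprod_axis_1 U1_conj_eq[OF q]
    by (simp add: axis_def \<gamma>_def \<sigma>_def)
  \<comment> \<open>Both are inner products of orbit curves, hence differentiable at 0.\<close>
  have "\<gamma> t = inner (right_mult (\<phi> t (axis k 1)) ?j) (\<phi> t (axis k ?j))"
    "\<sigma> t = - inner (right_mult (\<phi> t (axis k 1)) ?k) (\<phi> t (axis k ?j))" for t
    unfolding qRe_hprod[symmetric] hprod_right_mult hp by simp_all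
  then have \<gamma>_eq: "\<gamma> = (\<lambda>t. inner (right_mult (\<phi> t (axis k 1)) ?j) (\<phi> t (axis k ?j)))"
    and \<sigma>_eq: "\<sigma> = (\<lambda>t. - inner (right_mult (\<phi> t (axis k 1)) ?k) (\<phi> t (axis k ?j)))"
    by (intro ext, simp)+
  have rm: "((\<lambda>t. right_mult (\<phi> t (axis k 1)) h) has_vector_derivative right_mult (Y (axis k 1)) h) (at 0)" for h
    using bounded_linear.has_vector_derivative[OF bounded_bilinear.bounded_linear_left[OF right_mult_bounded_bilinear] deriv[OF ax(1)]] .
  note inner' = bounded_bilinear.has_vector_derivative[OF bounded_bilinear_inner rm deriv[OF ax(2)]]
  have "\<exists>d. (\<gamma> has_real_derivative d) (at 0)" "\<exists>d. (\<sigma> has_real_derivative d) (at 0)"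
    unfolding \<gamma>_eq \<sigma>_eq has_real_derivative_iff_has_vector_derivative
    using inner'[of ?j] has_vector_derivative_minus[OF inner'[of ?k]] by blast+
  then obtain \<gamma>' \<sigma>' where \<gamma>': "(\<gamma> has_real_derivative \<gamma>') (at 0)" and \<sigma>': "(\<sigma> has_real_derivative \<sigma>') (at 0)"
    by blast
  have "Quat 0 0 (\<gamma> 0) (- \<sigma> 0) = ?j"
    using hp[of 0] unfolding id[OF ax(1)] id[OF ax(2)] hprod_axis_1 by (simp add: axis_def)
  then have \<gamma>0: "\<gamma> 0 = 1" and \<sigma>0: "\<sigma> 0 = 0" by simp_all
  have "((\<lambda>t. (\<gamma> t)\<^sup>2 + (\<sigma> t)\<^sup>2) has_real_derivative 2 * \<gamma> 0 * \<gamma>' + 2 * \<sigma> 0 * \<sigma>') (at 0)"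
    by (auto intro!: derivative_eq_intros \<gamma>' \<sigma>')
  then have "((\<lambda>t::real. 1) has_real_derivative 2 * \<gamma>') (at 0)"
    unfolding \<gamma>\<sigma>1 \<gamma>0 \<sigma>0 by simp
  then have \<gamma>'0: "\<gamma>' = 0" using DERIV_unique[OF DERIV_const] by fastforce
  \<comment> \<open>The square of \<open>q t\<close> turns twice as fast as \<open>q t\<close>,
    hence the factor 1/2. Column \<open>l\<close> of \<open>X\<close> is what remains of
    \<open>Y (axis l 1)\<close> after removing the U(1) part.\<close>
  define x where "x = \<sigma>' / 2"
  define X :: "quat^'m^'m" where "X = (\<chi> i l. Y (axis l 1) $ i - x *\<^sub>R (axis l (quat_of_complex \<i>) $ i))"
  have "Y v = generated_field (X, x) v" if v: "v \<in> usphere" for v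
  proof -
    let ?\<rho> = "\<lambda>t h. Quat (qRe h) (qI h) (\<gamma> t * qJ h + \<sigma> t * qK h) (\<gamma> t * qK h - \<sigma> t * qJ h)"
    have \<rho>: "quat_cnj (q t) * h * q t = ?\<rho> t h" for t h
      unfolding U1_conj_eq[OF q] \<gamma>_def \<sigma>_def ..
    have "\<phi> t v = (\<Sum>l\<in>UNIV. right_mult (\<phi> t (axis l 1)) (?\<rho> t (v $ l)))" for t
      unfolding \<phi>_app[OF v] \<phi>_app[OF ax(1)] \<rho>[symmetric] by (rule sp_u1_action_columns[OF U1_norm[OF q]])
    moreover have "((\<lambda>t. ?\<rho> t h) has_vector_derivative Quat 0 0 (\<sigma>' * qK h) (- \<sigma>' * qJ h)) (at 0)" for h
      by (intro quat_has_vector_derivative) (auto intro!: derivative_eq_intros \<gamma>' \<sigma>' simp: \<gamma>'0)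
    from bounded_bilinear.has_vector_derivative[OF right_mult_bounded_bilinear deriv[OF ax(1)] this]
    have "((\<lambda>t. \<Sum>l\<in>UNIV. right_mult (\<phi> t (axis l 1)) (?\<rho> t (v $ l))) has_vector_derivative
        (\<Sum>l\<in>UNIV. right_mult (\<phi> 0 (axis l 1)) (Quat 0 0 (\<sigma>' * qK (v $ l)) (- \<sigma>' * qJ (v $ l))) +
          right_mult (Y (axis l 1)) (?\<rho> 0 (v $ l)))) (at 0)"
      by (intro has_vector_derivative_sum)
    ultimately have "Y v = (\<Sum>l\<in>UNIV. right_mult (\<phi> 0 (axis l 1)) (Quat 0 0 (\<sigma>' * qK (v $ l)) (- \<sigma>' * qJ (v $ l))) +
          right_mult (Y (axis l 1)) (?\<rho> 0 (v $ l)))"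
      using vector_derivative_unique_at[OF deriv[OF v]] by simp
    also have "\<dots> = (\<Sum>l\<in>UNIV. right_mult (axis l 1) (Quat 0 0 (\<sigma>' * qK (v $ l)) (- \<sigma>' * qJ (v $ l)))) +
        (\<Sum>l\<in>UNIV. right_mult (Y (axis l 1)) (v $ l))"
      unfolding id[OF ax(1)] \<gamma>0 \<sigma>0 sum.distrib[symmetric] by simp
    finally have "Y v $ i = Quat 0 0 (\<sigma>' * qK (v $ i)) (- \<sigma>' * qJ (v $ i)) + (\<Sum>l\<in>UNIV. Y (axis l 1) $ i * v $ l)" for i
      by (simp add: axis_def if_distrib[of "\<lambda>x. x * _"] cong: if_cong)
    moreover have "(X *v v) $ i = (\<Sum>l\<in>UNIV. Y (axis l 1) $ i * v $ l) - x *\<^sub>R (quat_of_complex \<i> * v $ i)" for i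
      by (simp add: X_def matrix_vector_mult_def algebra_simps sum_subtractf axis_def
          if_distrib[of "\<lambda>x. x * _"] if_distrib[of "scaleR _"] cong: if_cong)
    \<comment> \<open>The derivative of the conjugation is a commutator with i: one term is the
      right multiplication by i, the other cancels the correction built into
      \<open>X\<close>.\<close>
    moreover have "Quat 0 0 (\<sigma>' * qK h) (- \<sigma>' * qJ h) = x *\<^sub>R (h * quat_of_complex \<i>) - x *\<^sub>R (quat_of_complex \<i> * h)" for h
      by (simp add: quat_eq_iff x_def)
    ultimately show ?thesis
      by (simp add: vec_eq_iff generated_field_def)
  qed
  then show ?thesis by blast
qed

text \<open>The U(1) part is always tangent, so \<open>X *v v\<close> is orthogonal to
  \<open>v\<close>. Polarization makes \<open>X\<close> skew for the real inner product, and
  multiples of the \<open>axis\<close> vectors by 1, i, j, k recover the quaternionic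
  entries.\<close>

lemma generated_field_tangent_imp_skew:
  fixes X :: "quat^'m^'m"
  assumes "\<And>v. v \<in> usphere \<Longrightarrow> generated_field (X, x) v \<in> tangent v"
  shows "conj_transpose X = - X"
proof -
  have lin: "linear (\<lambda>v. X *v v)" by (rule quat_matrix_linear)
  have "inner v (right_mult v (quat_of_complex \<i>)) = 0" for v :: "quat^'m"
    unfolding qRe_hprod[symmetric] hprod_right_mult hprod_self by (simp add: of_real_def)
  then have unit: "inner v (X *v v) = 0" if "v \<in> usphere" for v
    using assms[OF that] by (simp add: tangent_def generated_field_def inner_add_right)
  have all: "inner v (X *v v) = 0" for v
  proof (cases "v = 0")
    case False
    have "inner (sgn v) (X *v sgn v) = 0" using False by (intro unit) (simp add: norm_sgn)
    then show ?thesis using False by (simp add: sgn_div_norm linear_scale[OF lin])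
  qed simp
  have skew: "inner u (X *v v) = - inner v (X *v u)" for u v
    using all[of "u + v"] all[of u] all[of v] by (simp add: linear_add[OF lin] inner_simps)
  have ax: "(X *v axis j h) $ i = X $ i $ j * h" for i j h
    by (simp add: matrix_vector_mult_def axis_def if_distrib[of "\<lambda>x. _ * x"] cong: if_cong)
  have ent: "inner h (X $ i $ j * h') = - inner h' (X $ j $ i * h)" for i j h h'
    using skew[of "axis i h" "axis j h'"] by (simp add: inner_axis' ax)
  have "quat_cnj (X $ j $ i) = - X $ i $ j" for i j
    using ent[of 1 i j 1] ent[of "Quat 0 1 0 0" i j 1] ent[of "Quat 0 0 1 0" i j 1] ent[of "Quat 0 0 0 1" i j 1]
    by (simp add: inner_quat_def quat_eq_iff)
  then show ?thesis by (simp add: conj_transpose_def vec_eq_iff)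
qed

lemma killing_field_generated:
  fixes Y :: "quat^'m \<Rightarrow> quat^'m"
  assumes K: "killing_field F Y" and comp: "identity_component F = Sp_U1"
  obtains X x where "conj_transpose X = - X" "\<And>v. v \<in> usphere \<Longrightarrow> Y v = generated_field (X, x) v"
proof -
  obtain \<phi> where "\<And>t. \<phi> t \<in> Sp_U1" "\<And>p. p \<in> usphere \<Longrightarrow> \<phi> 0 p = p"
    "\<And>p. p \<in> usphere \<Longrightarrow> ((\<lambda>s. \<phi> s p) has_vector_derivative Y p) (at 0)"
    using killing_flow_in_identity_component[OF K] unfolding comp by blast
  then obtain X x where X: "\<And>v. v \<in> usphere \<Longrightarrow> Y v = generated_field (X, x) v"
    using Sp_U1_curve_derivative[of \<phi> Y] by blast
  have "generated_field (X, x) v \<in> tangent v" if "v \<in> usphere" for v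
    using K that X unfolding killing_field_def by metis
  from that[OF generated_field_tangent_imp_skew[OF this] X] show thesis .
qed

section \<open>Killing vector fields of constant length\<close>

text \<open>With right multiplication by i as complex structure, each quaternionic coordinate splits
  into two complex ones. Only one of them is rotated, so the map is unitary without being
  quaternionic linear in general.\<close>

definition coord_rotation :: "'m \<Rightarrow> real \<Rightarrow> quat^'m \<Rightarrow> quat^'m" where
  "coord_rotation k t v = (\<chi> i. if i = k then Quat (cos t * qRe (v $ i) - sin t * qI (v $ i))
     (sin t * qRe (v $ i) + cos t * qI (v $ i)) (qJ (v $ i)) (qK (v $ i)) else v $ i)"

definition coord_rotation_field :: "'m \<Rightarrow> quat^'m \<Rightarrow> quat^'m" where
  "coord_rotation_field k v = axis k (Quat (- qI (v $ k)) (qRe (v $ k)) 0 0)"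

lemma coord_rotation_linear: "linear (coord_rotation k t)"
  by (rule linearI) (auto simp: coord_rotation_def vec_eq_iff quat_eq_iff algebra_simps)

lemma coord_rotation_field_linear: "linear (coord_rotation_field k)"
  by (rule linearI) (auto simp: coord_rotation_field_def axis_def vec_eq_iff quat_eq_iff algebra_simps)

lemma coord_rotation_inverse: "coord_rotation k (- t) (coord_rotation k t v) = v"
proof -
  have cs: "cos t * (cos t * x) + sin t * (sin t * x) = x" for x
  proof -
    have "cos t * (cos t * x) + sin t * (sin t * x) = ((cos t)\<^sup>2 + (sin t)\<^sup>2) * x"
      by (simp only: distrib_right mult.assoc power2_eq_square)
    then show ?thesis by simp
  qed
  show ?thesis
    by (auto simp: coord_rotation_def vec_eq_iff quat_eq_iff algebra_simps cs)
qed

lemma coord_rotation_inner: "inner (coord_rotation k t v) (coord_rotation k t w) = inner v w"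
proof -
  have "(c * a - s * b) * (c * a' - s * b') + (s * a + c * b) * (s * a' + c * b') =
      (s\<^sup>2 + c\<^sup>2) * (a * a' + b * b')" for c s a b a' b' :: real
    by (simp add: algebra_simps power2_eq_square)
  then show ?thesis
    by (auto simp: inner_vec_def coord_rotation_def inner_quat_def intro!: sum.cong)
qed

lemma coord_rotation_norm: "norm (coord_rotation k t v) = norm v"
  by (simp add: norm_eq_sqrt_inner coord_rotation_inner)

lemma coord_rotation_right_mult_i:
  "coord_rotation k t (right_mult v (quat_of_complex \<i>)) = right_mult (coord_rotation k t v) (quat_of_complex \<i>)"
  by (auto simp: coord_rotation_def vec_eq_iff quat_eq_iff)

lemma axis_bounded_linear: "bounded_linear (axis k :: quat \<Rightarrow> quat^'m)"
  by (intro linear_conv_bounded_linear[THEN iffD1] linearI) (auto simp: axis_def vec_eq_iff)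

lemma coord_rotation_derivative:
  "((\<lambda>t. coord_rotation k t v) has_vector_derivative coord_rotation_field k (coord_rotation k t v)) (at t)"
proof -
  let ?z = "v $ k"
  have eq: "coord_rotation k t v = v + axis k (Quat ((cos t - 1) * qRe ?z - sin t * qI ?z)
      (sin t * qRe ?z + (cos t - 1) * qI ?z) 0 0)" for t
    by (auto simp: coord_rotation_def vec_eq_iff quat_eq_iff axis_def algebra_simps)
  have "((\<lambda>t. Quat ((cos t - 1) * qRe ?z - sin t * qI ?z) (sin t * qRe ?z + (cos t - 1) * qI ?z) 0 0)
      has_vector_derivative Quat (- sin t * qRe ?z - cos t * qI ?z) (cos t * qRe ?z - sin t * qI ?z) 0 0) (at t)"
    by (intro quat_has_vector_derivative) (auto intro!: derivative_eq_intros)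
  from has_vector_derivative_add[OF has_vector_derivative_const[of v]
      bounded_linear.has_vector_derivative[OF axis_bounded_linear this]]
  have "((\<lambda>t. coord_rotation k t v) has_vector_derivative
      0 + axis k (Quat (- sin t * qRe ?z - cos t * qI ?z) (cos t * qRe ?z - sin t * qI ?z) 0 0)) (at t)"
    unfolding eq[abs_def] .
  moreover have "0 + axis k (Quat (- sin t * qRe ?z - cos t * qI ?z) (cos t * qRe ?z - sin t * qI ?z) 0 0) =
      coord_rotation_field k (coord_rotation k t v)"
    by (simp add: coord_rotation_field_def coord_rotation_def)
  ultimately show ?thesis by simp
qed

text \<open>If \<open>c = a\<close>, the metric only sees the complex structure \<open>v \<mapsto> v\<i>\<close> and is invariant under
  all of \<open>U(2n+2)\<close>, which contains the group \<open>coord_rotation k\<close>.\<close>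

lemma berger_randers_equal_unitary:
  fixes L :: "quat^'a \<Rightarrow> quat^'a"
  assumes L: "linear L" and inner: "\<And>v w. inner (L v) (L w) = inner v w"
    and J: "\<And>v. L (right_mult v (quat_of_complex \<i>)) = right_mult (L v) (quat_of_complex \<i>)"
  shows "berger_randers a b a d (L p) (L w) = berger_randers a b a d p w"
proof -
  have "berger_randers a b a d p w = sqrt (a * ((norm w)\<^sup>2 - (inner p w)\<^sup>2) +
    (b - a) * (inner (right_mult p (quat_of_complex \<i>)) w)\<^sup>2) + d * inner (right_mult p (quat_of_complex \<i>)) w"
    for p w :: "quat^'a"
    unfolding berger_randers_def Let_def qJK_norm qI_hprod qRe_hprod by (simp add: algebra_simps)
  moreover have "norm (L w) = norm w" by (simp add: norm_eq_sqrt_inner inner)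
  moreover have "inner (right_mult (L p) (quat_of_complex \<i>)) (L w) = inner (right_mult p (quat_of_complex \<i>)) w"
    by (simp add: J[symmetric] inner)
  ultimately show ?thesis by (simp add: inner)
qed

lemma coord_rotation_field_killing:
  assumes F: "\<And>p w. p \<in> usphere \<Longrightarrow> w \<in> tangent p \<Longrightarrow> F p w = berger_randers a b a d p w"
  shows "killing_field F (coord_rotation_field k)"
proof -
  have iso: "restrict (coord_rotation k t) usphere \<in> isometries F" for t
  proof (rule linear_in_isometries[OF coord_rotation_linear coord_rotation_linear[of k "- t"]])
    show "coord_rotation k t (coord_rotation k (- t) x) = x" for x
      using coord_rotation_inverse[of k "- t" x] by simp
    fix p v :: "quat^'a" assume p: "p \<in> usphere" and v: "v \<in> tangent p"
    have "coord_rotation k t p \<in> usphere" "coord_rotation k t v \<in> tangent (coord_rotation k t p)"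
      using p v by (simp_all add: coord_rotation_norm tangent_def coord_rotation_inner)
    then show "F (coord_rotation k t p) (coord_rotation k t v) = F p v"
      using p v by (simp add: F berger_randers_equal_unitary coord_rotation_linear coord_rotation_inner
          coord_rotation_right_mult_i)
  qed (simp_all add: coord_rotation_inverse coord_rotation_norm)
  have "inner p (coord_rotation_field k p) = 0" for p
    by (simp add: coord_rotation_field_def inner_axis inner_quat_def)
  moreover have "restrict (coord_rotation k 0) usphere p = p" if "p \<in> usphere" for p
    using that by (simp add: coord_rotation_def vec_eq_iff quat_eq_iff)
  moreover have "((\<lambda>s. restrict (coord_rotation k s) usphere p) has_vector_derivative
      coord_rotation_field k (restrict (coord_rotation k t) usphere p)) (at t)" if "p \<in> usphere" for p t
    unfolding restrict_apply'[OF that] by (rule coord_rotation_derivative)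
  ultimately show ?thesis
    unfolding killing_field_def
    using iso smooth_on_linear[OF coord_rotation_field_linear refl]
    by (auto simp: tangent_def intro!: exI[of _ "\<lambda>t. restrict (coord_rotation k t) usphere"])
qed

lemma matrix_axis: "(X *v axis j (h :: quat)) $ i = X $ i $ j * h"
  by (simp add: matrix_vector_mult_def axis_def if_distrib[of "\<lambda>x. _ * x"] cong: if_cong)

text \<open>The field vanishes on coordinate \<open>l\<close>, and its values at
  \<open>axis l 1\<close> and \<open>axis l ?j\<close> then force \<open>x = 0\<close>. On
  coordinate \<open>k\<close>, left multiplication by one quaternion would have to send 1 to i but j
  to 0.\<close>

lemma coord_rotation_field_not_generated:
  assumes l: "l \<noteq> k" and gen: "\<And>v. v \<in> usphere \<Longrightarrow> coord_rotation_field k v = generated_field (X, x) v"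
  shows False
proof -
  let ?j = "Quat 0 0 1 0"
  have ax: "axis m (1 :: quat) \<in> usphere" "axis m ?j \<in> usphere" for m :: 'a
    by (simp_all add: norm_axis norm_quat_def)
  have E: "coord_rotation_field k (axis m h) $ m = X $ m $ m * h + x *\<^sub>R (h * quat_of_complex \<i>)"
    if "axis m h \<in> usphere" for m h
    unfolding gen[OF that] by (simp add: generated_field_def matrix_axis)
  have "X $ l $ l * 1 + x *\<^sub>R (1 * quat_of_complex \<i>) = 0" "X $ l $ l * ?j + x *\<^sub>R (?j * quat_of_complex \<i>) = 0"
    using E[OF ax(1), of l] E[OF ax(2), of l] l by (simp_all add: coord_rotation_field_def axis_def)
  then have x: "x = 0" by (simp add: quat_eq_iff)
  have "X $ k $ k * 1 = Quat 0 1 0 0" "X $ k $ k * ?j = 0"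
    using E[OF ax(1), of k] E[OF ax(2), of k] by (simp_all add: coord_rotation_field_def x axis_def quat_eq_iff)
  then show False by (simp add: quat_eq_iff)
qed

section \<open>From constant length to the vanishing of the matrix\<close>

lemma hprod_commute: "hprod w p = quat_cnj (hprod p w)"
  by (simp add: hprod_def quat_cnj_sum quat_cnj_mult)

lemma skew_hprod:
  assumes "conj_transpose X = - X"
  shows "hprod v (X *v w) = - quat_cnj (hprod w (X *v v))"
proof -
  have "hprod v (X *v w) = quat_cnj (hprod (X *v w) v)" by (rule hprod_commute)
  also have "hprod (X *v w) v = hprod w ((- X) *v v)" by (simp only: hprod_mult_vec assms)
  also have "(- X) *v v = - (X *v v)" by (simp add: vec_eq_iff matrix_vector_mult_def sum_negf)
  also have "hprod w (- (X *v v)) = - hprod w (X *v v)" using hprod_scaleR[of w "-1" "X *v v"] by simp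
  finally show ?thesis by (simp add: quat_eq_iff)
qed

lemma norm_right_mult: "norm (right_mult v t) = norm v * norm t"
proof -
  have "(norm (right_mult v t))\<^sup>2 = (norm v * norm t)\<^sup>2"
    by (simp add: power2_norm_eq_inner inner_vec_def power_mult_distrib)
      (simp add: power2_norm_eq_inner[symmetric] quat_norm_mult power_mult_distrib sum_distrib_right)
  then show ?thesis by simp
qed

text \<open>Replacing \<open>v\<close> by \<open>vt\<close> with a unit quaternion \<open>t\<close> conjugates \<open>v\<^sup>*Xv\<close>, so that its
  \<open>\<i>\<close>-component can be made \<open>0\<close>; the one-form then contributes only the constant \<open>d x\<close>.\<close>

lemma constant_length_quartic:
  assumes F: "\<And>p w. p \<in> usphere \<Longrightarrow> w \<in> tangent p \<Longrightarrow> F p w = berger_randers a b c d p w"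
    and X: "conj_transpose X = - X"
    and const: "\<And>v. v \<in> usphere \<Longrightarrow> F v (generated_field (X, x) v) = C"
  obtains K where
    "\<And>v. v \<in> usphere \<Longrightarrow> a * (norm (X *v v))\<^sup>2 + (c - a) * (norm (hprod v (X *v v)))\<^sup>2 = K"
proof -
  let ?i = "quat_of_complex \<i>"
  define G where "G = (\<lambda>v. a * (norm (X *v v))\<^sup>2 + (c - a) * (norm (hprod v (X *v v)))\<^sup>2)"
  have main: "sqrt (G v + b * x\<^sup>2) + d * x = C" if v: "v \<in> usphere" for v
  proof -
    obtain t where t: "norm t = 1" "qI (quat_cnj t * hprod v (X *v v) * t) = 0"
      using unit_quat_rotation_zero_I by blast
    define v' where "v' = right_mult v t"
    define Q where "Q = hprod v' (X *v v')"
    have v': "v' \<in> usphere" using v t by (simp add: v'_def norm_right_mult)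
    have Q_eq: "Q = quat_cnj t * hprod v (X *v v) * t"
      by (simp add: Q_def v'_def matrix_right_mult hprod_right_mult mult.assoc)
    \<comment> \<open>Skewness makes \<open>Q\<close> imaginary, and the choice of \<open>t\<close>
      removes its i component; only its j and k components remain, so \<open>Q\<close> is weighted
      by \<open>c\<close>.\<close>
    have "Q = - quat_cnj Q" unfolding Q_def by (rule skew_hprod[OF X])
    then have Q0: "qRe Q = 0" "qI Q = 0" using t(2) by (simp_all add: quat_eq_iff flip: Q_eq)
    have nQ: "norm Q = norm (hprod v (X *v v))" by (simp add: Q_eq quat_norm_mult t)
    have nX: "norm (X *v v') = norm (X *v v)" by (simp add: v'_def matrix_right_mult norm_right_mult t)
    let ?w = "generated_field (X, x) v'"
    have h: "hprod v' ?w = Q + x *\<^sub>R ?i"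
      using v' by (simp add: generated_field_def hprod_add hprod_scaleR hprod_right_mult hprod_self Q_def)
    then have "?w \<in> tangent v'" by (simp add: tangent_def qRe_hprod[symmetric] Q0)
    then have "berger_randers a b c d v' ?w = C" using F[OF v'] const[OF v'] by simp
    moreover have "(norm ?w)\<^sup>2 = (norm (X *v v'))\<^sup>2 + x\<^sup>2"
    proof -
      \<comment> \<open>The cross term in the squared length of \<open>?w\<close> is the i component
        of \<open>Q\<close>, which is 0.\<close>
      have "inner (right_mult v' ?i) (X *v v') = 0" unfolding qI_hprod[symmetric] using Q0 by (simp add: Q_def)
      moreover have "norm (right_mult v' ?i) = 1" using v' by (simp add: norm_right_mult norm_quat_def)
      ultimately show ?thesis
        unfolding power2_norm_eq_inner
        by (simp add: generated_field_def inner_simps inner_commute norm_eq_1) (simp add: power2_eq_square)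
    qed
    ultimately show ?thesis
      by (simp add: berger_randers_def h Let_def quat_norm_sq[of "Q + x *\<^sub>R ?i"] Q0 G_def nX[symmetric] nQ[symmetric]
          quat_norm_sq[of Q] algebra_simps)
  qed
  \<comment> \<open>\<open>sqrt\<close> is injective on all reals, so the values of \<open>G\<close>
    can be compared directly.\<close>
  have "G v = G w" if "v \<in> usphere" "w \<in> usphere" for v w
    using main[OF that(1)] main[OF that(2)] by (metis add_right_cancel real_sqrt_eq_iff)
  then have "G v = G (axis k 1)" if "v \<in> usphere" for v and k :: 'a
    using that axis_1_usphere by blast
  then show thesis using that unfolding G_def by blast
qed

text \<open>The parallelogram law balances the terms weighted by \<open>a\<close> between
  \<open>v1\<close>, \<open>v2\<close> and their normalized sum and difference. What is left carries
  the nonzero factor \<open>c - a\<close> and is the hypothesis of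
  \<open>quat_conj_sandwich_rigid\<close>.\<close>

lemma quartic_constant_imp_zero:
  fixes X :: "quat^'m^'m"
  assumes ac: "a \<noteq> c" and X: "conj_transpose X = - X"
    and K: "\<And>v. v \<in> usphere \<Longrightarrow> a * (norm (X *v v))\<^sup>2 + (c - a) * (norm (hprod v (X *v v)))\<^sup>2 = K"
    and ij: "i \<noteq> j"
  shows "X $ i $ i = 0" "X $ j $ i = 0"
proof -
  define m where "m = c - a"
  have m: "m \<noteq> 0" using ac by (simp add: m_def)
  note lin = quat_matrix_linear[of X]
  have diag: "qRe (X $ i $ i) = 0" for i
  proof -
    have "conj_transpose X $ i $ i = (- X) $ i $ i" by (simp only: X)
    then show ?thesis by (simp add: conj_transpose_def quat_eq_iff)
  qed
  have E: "(norm (X $ i $ i - quat_cnj u * X $ j $ j * u))\<^sup>2 =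
      4 * ((norm (quat_cnj u * X $ j $ i))\<^sup>2 - (qRe (quat_cnj u * X $ j $ i))\<^sup>2)" if u: "norm u = 1" for u
  proof -
    define v1 v2 where "v1 = (axis i 1 :: quat^'m)" and "v2 = (axis j u :: quat^'m)"
    define q p R where "q = hprod v1 (X *v v1)" and "p = hprod v2 (X *v v2)"
      and "R = hprod v1 (X *v v2) + hprod v2 (X *v v1)"
    have q: "q = X $ i $ i" by (simp add: q_def v1_def hprod_axis matrix_axis)
    have p: "p = quat_cnj u * X $ j $ j * u" by (simp add: p_def v2_def hprod_axis matrix_axis mult.assoc)
    have mu: "hprod v2 (X *v v1) = quat_cnj u * X $ j $ i" by (simp add: v1_def v2_def hprod_axis matrix_axis)
    have sub_cnj: "(norm (h - quat_cnj h))\<^sup>2 = 4 * ((norm h)\<^sup>2 - (qRe h)\<^sup>2)" for h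
      unfolding quat_norm_sq by (simp add: power2_eq_square)
    \<comment> \<open>By skewness the mixed terms add up to twice an imaginary part, so the norm of
      \<open>R\<close> is that of the right side of \<open>E\<close>.\<close>
    have "R = hprod v2 (X *v v1) - quat_cnj (hprod v2 (X *v v1))"
      unfolding R_def skew_hprod[OF X, of v1 v2] by simp
    then have R: "(norm R)\<^sup>2 = 4 * ((norm (quat_cnj u * X $ j $ i))\<^sup>2 - (qRe (quat_cnj u * X $ j $ i))\<^sup>2)"
      unfolding mu by (simp only: sub_cnj)
    have n: "norm v1 = 1" "norm v2 = 1" "inner v1 v2 = 0"
      using u ij by (simp_all add: v1_def v2_def norm_axis inner_axis_axis)
    let ?s = "sqrt (1/2) :: real"
    have half: "?s * ?s = 1/2" by simp
    have pm: "norm (v1 + v2) = sqrt 2" "norm (v1 - v2) = sqrt 2"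
      using n by (simp_all add: norm_eq_sqrt_inner inner_simps norm_eq_1 inner_commute)
    \<comment> \<open>Normalizing by \<open>?s\<close> divides the quadratic term by 2 and the
      quartic term by 4.\<close>
    have "a * (norm (X *v (?s *\<^sub>R V)))\<^sup>2 + m * (norm (hprod (?s *\<^sub>R V) (X *v (?s *\<^sub>R V))))\<^sup>2 =
      a / 2 * (norm (X *v V))\<^sup>2 + m / 4 * (norm (hprod V (X *v V)))\<^sup>2" for V
    proof -
      have "hprod (?s *\<^sub>R V) (X *v (?s *\<^sub>R V)) = (1/2) *\<^sub>R hprod V (X *v V)"
        unfolding linear_scale[OF lin] hprod_scaleR hprod_commute[of "?s *\<^sub>R V"]
        by (simp add: hprod_scaleR quat_eq_iff hprod_commute[of V "X *v V"] half mult.assoc[symmetric])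
      then show ?thesis
        by (simp add: linear_scale[OF lin] power_mult_distrib power_divide)
    qed
    moreover have "norm (?s *\<^sub>R (v1 + v2)) = 1" "norm (?s *\<^sub>R (v1 - v2)) = 1"
      by (simp_all add: pm real_sqrt_mult[symmetric])
    ultimately have
      Kp: "a / 2 * (norm (X *v (v1 + v2)))\<^sup>2 + m / 4 * (norm (hprod (v1 + v2) (X *v (v1 + v2))))\<^sup>2 = K" and
      Km: "a / 2 * (norm (X *v (v1 - v2)))\<^sup>2 + m / 4 * (norm (hprod (v1 - v2) (X *v (v1 - v2))))\<^sup>2 = K"
      using K[of "?s *\<^sub>R (v1 + v2)"] K[of "?s *\<^sub>R (v1 - v2)"] by (simp_all add: m_def)
    have K1: "a * (norm (X *v v1))\<^sup>2 + m * (norm q)\<^sup>2 = K" and K2: "a * (norm (X *v v2))\<^sup>2 + m * (norm p)\<^sup>2 = K"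
      using K[of v1] K[of v2] n by (simp_all add: m_def q_def p_def)
    have para: "(norm (y + z))\<^sup>2 + (norm (y - z))\<^sup>2 = 2 * (norm y)\<^sup>2 + 2 * (norm z)\<^sup>2" for y z :: "'z::real_inner"
      by (simp add: power2_norm_eq_inner inner_simps)
    have hdiff: "hprod (y - z) w = hprod y w - hprod z w" "hprod w (y - z) = hprod w y - hprod w z" for y z w :: "quat^'m"
      using hprod_add(1)[of w "y - z" z] hprod_add(2)[of "y - z" z w] by (simp_all add: eq_diff_eq)
    have Qp: "hprod (v1 + v2) (X *v (v1 + v2)) = (q + p) + R"
      by (simp add: linear_add[OF lin] hprod_add q_def p_def R_def algebra_simps)
    have Qm: "hprod (v1 - v2) (X *v (v1 - v2)) = (q + p) - R"
      by (simp add: linear_diff[OF lin] hdiff q_def p_def R_def algebra_simps)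
    \<comment> \<open>Adding \<open>Kp\<close> and \<open>Km\<close> prepares two parallelogram
      laws, one for the images under \<open>X\<close> and one for \<open>q + p\<close> and
      \<open>R\<close>.\<close>
    have "2 * K = a / 2 * ((norm (X *v v1 + X *v v2))\<^sup>2 + (norm (X *v v1 - X *v v2))\<^sup>2) +
        m / 4 * ((norm ((q + p) + R))\<^sup>2 + (norm ((q + p) - R))\<^sup>2)"
      using Kp[unfolded Qp] Km[unfolded Qm] unfolding linear_add[OF lin] linear_diff[OF lin] by (simp add: algebra_simps)
    also have "\<dots> = a * (norm (X *v v1))\<^sup>2 + a * (norm (X *v v2))\<^sup>2 + m / 2 * ((norm (q + p))\<^sup>2 + (norm R)\<^sup>2)"
      unfolding para by (simp add: algebra_simps)
    finally have "m * (2 * (norm q)\<^sup>2 + 2 * (norm p)\<^sup>2 - (norm (q + p))\<^sup>2 - (norm R)\<^sup>2) = 0"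
      using K1 K2 by (simp add: algebra_simps)
    then have "2 * (norm q)\<^sup>2 + 2 * (norm p)\<^sup>2 - (norm (q + p))\<^sup>2 - (norm R)\<^sup>2 = 0" using m by simp
    then have "(norm (q - p))\<^sup>2 = (norm R)\<^sup>2" using para[of q p] by linarith
    then show ?thesis unfolding R q p .
  qed
  show "X $ i $ i = 0" by (rule quat_conj_sandwich_rigid(1)[OF diag diag E])
  show "X $ j $ i = 0" by (rule quat_conj_sandwich_rigid(2)[OF diag diag E])
qed

theorem theorem6p3:
  fixes n :: nat
    and F :: "quat^'m::finite \<Rightarrow> quat^'m \<Rightarrow> real"
    and Y :: "quat^'m \<Rightarrow> quat^'m"
  assumes "n \<ge> 1"
    and "CARD('m) = n + 1"
    and "non_riemannian_randers F"
    and "homogeneous_metric F"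
    and "identity_component F = Sp_U1"
    and "killing_field F Y"
    and "constant_length F Y"
  shows "\<exists>z\<in>sp_u1_center. \<forall>v\<in>usphere. Y v = generated_field z v"
proof -
  \<comment> \<open>Since \<open>n\<close> is at least 1 there are two coordinates, as the test
    vectors require.\<close>
  have other: "\<exists>l. l \<noteq> k" for k :: 'm
  proof (rule ccontr)
    assume "\<nexists>l. l \<noteq> k"
    then have "(UNIV :: 'm set) = {k}" by auto
    then have "CARD('m) = 1" by (metis card.empty card_insert_disjoint empty_iff finite.emptyI One_nat_def)
    with assms(1,2) show False by simp
  qed
  fix k0 :: 'm
  obtain l0 where l0: "l0 \<noteq> k0" using other by blast
  obtain g \<beta> where "randers_decomposition F g \<beta>"
    using assms(3) unfolding non_riemannian_randers_def by blast
  then obtain a b c d where F: "\<And>p w. p \<in> usphere \<Longrightarrow> w \<in> tangent p \<Longrightarrow> F p w = berger_randers a b c d p w"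
    by (rule invariant_randers_normal_form[OF _ assms(5,4) l0]) blast
  have ac: "a \<noteq> c"
  proof
    assume "a = c"
    with F have "killing_field F (coord_rotation_field k0)"
      by (intro coord_rotation_field_killing[of F a b d]) simp
    then obtain X x where "\<And>v. v \<in> usphere \<Longrightarrow> coord_rotation_field k0 v = generated_field (X, x) v"
      using killing_field_generated[OF _ assms(5)] by metis
    then show False by (rule coord_rotation_field_not_generated[OF l0])
  qed
  obtain X x where X: "conj_transpose X = - X" and Y: "\<And>v. v \<in> usphere \<Longrightarrow> Y v = generated_field (X, x) v"
    using killing_field_generated[OF assms(6,5)] by metis
  obtain C where "\<And>v. v \<in> usphere \<Longrightarrow> F v (generated_field (X, x) v) = C"
    using assms(7) Y unfolding constant_length_def by metis
  then obtain K where K: "\<And>v. v \<in> usphere \<Longrightarrow>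
      a * (norm (X *v v))\<^sup>2 + (c - a) * (norm (hprod v (X *v v)))\<^sup>2 = K"
    using constant_length_quartic[OF F X] by metis
  \<comment> \<open>For \<open>i = j\<close> the diagonal conclusion is used together with some
    other index.\<close>
  have "X $ j $ i = 0" for i j
    using quartic_constant_imp_zero[OF ac X K] other by metis
  then have "X = 0" by (simp add: vec_eq_iff)
  then have "(X, x) \<in> sp_u1_center"
    using X by (simp add: sp_u1_center_def sp_u1_def sp_u1_bracket_def zero_prod_def split: prod.splits)
  with Y show ?thesis by blast
qed

end
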